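(* There is an algorithm that, given an $n$-vertex graph $G$ with maximum degree $\Delta$ and an integer $k$, decides in time $O^*\bigl((2^{\Delta+1}-1)^{n/(\Delta+1)}\bigr)$ whether the vertex set of $G$ can be covered by $k$ independent sets.
   Context: A set of vertices is independent if no two of its vertices are adjacent. The notation $O^*(\cdot)$ suppresses factors polynomial in $n$. *)

theory Defs
  imports Complex_Main "HOL-Library.Log_Nat"
begin

section \<open>Graphs\<close>

definition simple_graph :: "'a set \<Rightarrow> 'a set set \<Rightarrow> bool" where
  "simple_graph V E \<longleftrightarrow> finite V \<and> (\<forall>e\<in>E. e \<subseteq> V \<and> card e = 2)"

definition degree :: "'a set set \<Rightarrow> 'a \<Rightarrow> nat" where
  "degree E v = card {e \<in> E. v \<in> e}"

text \<open>The inserted \<open>0\<close> matters only for the graph without vertices.\<close>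

definition max_degree :: "'a set \<Rightarrow> 'a set set \<Rightarrow> nat" where
  "max_degree V E = Max (insert 0 (degree E ` V))"

definition independent_set :: "'a set \<Rightarrow> 'a set set \<Rightarrow> 'a set \<Rightarrow> bool" where
  "independent_set V E S \<longleftrightarrow> S \<subseteq> V \<and> (\<forall>u\<in>S. \<forall>v\<in>S. {u, v} \<notin> E)"

text \<open>The list may contain repetitions and empty sets. For negative \<open>k\<close> there is no cover.\<close>

definition coverable :: "'a set \<Rightarrow> 'a set set \<Rightarrow> int \<Rightarrow> bool" where
  "coverable V E k \<longleftrightarrow>
     (\<exists>Ss. int (length Ss) = k \<and> (\<forall>S \<in> set Ss. independent_set V E S) \<and> \<Union>(set Ss) = V)"

section \<open>Random access machine with logarithmic cost\<close>

text \<open>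
  Algorithms are programs of a structured language for a random access machine. The memory has a
  cell for every natural number, each cell holding a natural number. The input is a read-only
  list, also with random access; reading beyond its end yields \<open>0\<close>. \<open>Cell e\<close> and \<open>Input e\<close> are
  indirect, their address being the value of \<open>e\<close>. Subtraction is truncated and division is
  integer division, with value \<open>0\<close> for divisor \<open>0\<close>.
\<close>

datatype expr =
    Const nat
  | Cell expr
  | Input expr
  | Plus expr expr
  | Minus expr expr
  | Times expr expr
  | Div expr expr

datatype prog =
    Skip
  | Assign expr expr
  | Seq prog prog
  | If expr prog prog
  | While expr prog

type_synonym memory = "nat \<Rightarrow> nat"

fun val :: "nat list \<Rightarrow> memory \<Rightarrow> expr \<Rightarrow> nat" where
  "val xs m (Const a) = a"
| "val xs m (Cell e) = m (val xs m e)"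
| "val xs m (Input e) = (if val xs m e < length xs then xs ! val xs m e else 0)"
| "val xs m (Plus e f) = val xs m e + val xs m f"
| "val xs m (Minus e f) = val xs m e - val xs m f"
| "val xs m (Times e f) = val xs m e * val xs m f"
| "val xs m (Div e f) = val xs m e div val xs m f"

text \<open>The number of binary digits (\<open>floorlog 2 0 = 0\<close>, but \<open>0\<close> is charged as one digit).\<close>

definition len :: "nat \<Rightarrow> nat" where
  "len a = max 1 (floorlog 2 a)"

text \<open>
  Every operation is charged by the lengths of the numbers involved, addresses included.
  Multiplication and division are charged as in the schoolbook methods, so that arithmetic on
  long numbers cannot be used to hide work.
\<close>

fun cost :: "nat list \<Rightarrow> memory \<Rightarrow> expr \<Rightarrow> nat" where
  "cost xs m (Const a) = len a"
| "cost xs m (Cell e) = cost xs m e + len (val xs m e) + len (val xs m (Cell e))"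
| "cost xs m (Input e) = cost xs m e + len (val xs m e) + len (val xs m (Input e))"
| "cost xs m (Plus e f) = cost xs m e + cost xs m f + len (val xs m e) + len (val xs m f)"
| "cost xs m (Minus e f) = cost xs m e + cost xs m f + len (val xs m e) + len (val xs m f)"
| "cost xs m (Times e f) = cost xs m e + cost xs m f + len (val xs m e) * len (val xs m f)"
| "cost xs m (Div e f) = cost xs m e + cost xs m f + len (val xs m e) * len (val xs m f)"

text \<open>
  \<open>exec xs c m t m'\<close>: on input \<open>xs\<close>, the program \<open>c\<close> started with memory \<open>m\<close> halts after time \<open>t\<close>
  with memory \<open>m'\<close>. A test succeeds if its value is not \<open>0\<close>. In \<open>Assign a e\<close> the value of \<open>e\<close> is
  stored in the cell whose address is the value of \<open>a\<close>.
\<close>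

inductive exec :: "nat list \<Rightarrow> prog \<Rightarrow> memory \<Rightarrow> nat \<Rightarrow> memory \<Rightarrow> bool" for xs where
  Skip: "exec xs Skip m 1 m"
| Assign: "exec xs (Assign a e) m
     (cost xs m a + cost xs m e + len (val xs m a) + len (val xs m e))
     (m(val xs m a := val xs m e))"
| Seq: "exec xs c m t m' \<Longrightarrow> exec xs d m' t' m'' \<Longrightarrow> exec xs (Seq c d) m (t + t') m''"
| IfTrue: "val xs m b \<noteq> 0 \<Longrightarrow> exec xs c m t m' \<Longrightarrow> exec xs (If b c d) m (cost xs m b + 1 + t) m'"
| IfFalse: "val xs m b = 0 \<Longrightarrow> exec xs d m t m' \<Longrightarrow> exec xs (If b c d) m (cost xs m b + 1 + t) m'"
| WhileFalse: "val xs m b = 0 \<Longrightarrow> exec xs (While b c) m (cost xs m b + 1) m"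
| WhileTrue: "val xs m b \<noteq> 0 \<Longrightarrow> exec xs c m t m' \<Longrightarrow> exec xs (While b c) m' t' m'' \<Longrightarrow>
     exec xs (While b c) m (cost xs m b + 1 + t + t') m''"

inductive_cases SkipE: "exec xs Skip m t m'"
inductive_cases AssignE: "exec xs (Assign a e) m t m'"
inductive_cases SeqE: "exec xs (Seq c d) m t m'"
inductive_cases IfE: "exec xs (If b c d) m t m'"
inductive_cases WhileE: "exec xs (While b c) m t m'"

lemma exec_deterministic:
  "exec xs c m t m' \<Longrightarrow> exec xs c m u m'' \<Longrightarrow> t = u \<and> m' = m''"
proof (induction arbitrary: u m'' rule: exec.induct)
  case (Skip m)
  then show ?case by (auto elim: SkipE)
next
  case (Assign a e m)
  then show ?case by (auto elim: AssignE)
next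
  case (Seq c m t m1 d t' m2)
  from Seq.prems obtain t1 n1 t2 where
    "exec xs c m t1 n1" "exec xs d n1 t2 m''" "u = t1 + t2"
    by (rule SeqE)
  with Seq.IH(1)[of t1 n1] Seq.IH(2)[of t2 m''] show ?case by simp
next
  case (IfTrue m b c t m1 d)
  from IfTrue.prems IfTrue.hyps obtain t1 where
    "exec xs c m t1 m''" "u = cost xs m b + 1 + t1"
    by (auto elim: IfE)
  with IfTrue.IH[of t1 m''] show ?case by simp
next
  case (IfFalse m b d t m1 c)
  from IfFalse.prems IfFalse.hyps obtain t1 where
    "exec xs d m t1 m''" "u = cost xs m b + 1 + t1"
    by (auto elim: IfE)
  with IfFalse.IH[of t1 m''] show ?case by simp
next
  case (WhileFalse m b c)
  from WhileFalse.prems show ?case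
    by (rule WhileE) (simp_all add: WhileFalse.hyps)
next
  case (WhileTrue m b c t m1 t' m2)
  from WhileTrue.prems obtain t1 n1 t2 where
    "exec xs c m t1 n1" "exec xs (While b c) n1 t2 m''" "u = cost xs m b + 1 + t1 + t2"
    by (rule WhileE) (simp_all add: WhileTrue.hyps)
  with WhileTrue.IH(1)[of t1 n1] WhileTrue.IH(2)[of t2 m''] show ?case by simp
qed

text \<open>\<open>yields xs c t r\<close>: on input \<open>xs\<close>, with memory initially zero, \<open>c\<close> halts after time \<open>t\<close> with
  output \<open>r\<close> in cell \<open>0\<close>.\<close>

definition yields :: "nat list \<Rightarrow> prog \<Rightarrow> nat \<Rightarrow> nat \<Rightarrow> bool" where
  "yields xs c t r \<longleftrightarrow> (\<exists>m. exec xs c (\<lambda>_. 0) t m \<and> m 0 = r)"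

section \<open>Encoding of instances\<close>

definition bits :: "nat \<Rightarrow> nat list" where
  "bits a = map (\<lambda>i. a div 2 ^ i mod 2) [0..<floorlog 2 a]"

text \<open>
  An instance with vertex set \<open>{..<n}\<close> is given by \<open>n\<close>, the adjacency matrix row by row, the sign of
  \<open>k\<close> (\<open>1\<close> if negative), and the binary digits of \<open>\<bar>k\<bar>\<close>, one per cell, least significant first and
  closed by the end marker \<open>2\<close>. Since \<open>k\<close> does not sit in a single cell, the mere access to a
  huge \<open>k\<close> is not charged by its length, and time bounds depending on the graph alone make sense.
\<close>

definition encode :: "nat \<Rightarrow> nat set set \<Rightarrow> int \<Rightarrow> nat list" where
  "encode n E k =
     [n] @ [of_bool ({u, v} \<in> E). u \<leftarrow> [0..<n], v \<leftarrow> [0..<n]]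
         @ [of_bool (k < 0)] @ bits (nat \<bar>k\<bar>) @ [2]"

end

theory Submission
  imports Defs "HOL-Analysis.Convex" "HOL-Library.Nat_Bijection"
begin

text \<open>
  Every maximal independent set is dominating, so with \<open>a(X)\<close> the number of maximal independent
  sets inside \<open>X\<close>, the inclusion-exclusion sum of \<open>(-1)^|X| a(X)^k\<close> needs only the dominating \<open>X\<close>
  if \<open>k > 0\<close>; it is nonzero iff the graph can be covered by \<open>k\<close> independent sets. The values \<open>a(X)\<close>
  come from the zeta transform restricted to dominating sets, which suffices because these are
  closed under supersets; for the same reason they can be listed with polynomial delay by deleting
  vertices in order. A dominating set meets every closed neighbourhood, so it leaves one of at most
  \<open>2^(deg v + 1) - 1\<close> traces on that of \<open>v\<close>, and Shearer's inequality (in the product form of Chung,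
  Frankl, Graham and Shearer) bounds the number of dominating sets by the base of the running time.
\<close>

section \<open>The number of dominating sets\<close>

text \<open>Closed neighbourhoods overlap, so the bounds for their traces cannot simply be
  multiplied; Shearer's inequality compensates for each vertex being counted \<Delta> + 1 times,
  which is where the exponent \<open>n / (\<Delta> + 1)\<close> comes from. A small number of
  dominating sets is not yet a small running time, because costs are logarithmic and
  \<open>k\<close> is unbounded. For \<open>k \<ge> n\<close> singletons form a cover, and a
  \<open>k\<close> with more than \<open>n\<close> digits is noticed after \<open>n + 1\<close> of
  its cells. Hence powers are formed only with exponents below \<open>n\<close>, and all numbers
  have polynomially many digits. The table of the transform is addressed by all \<open>2 ^ n\<close>
  vertex sets, too many to initialise in time. But memory starts as zero, and zero is the right
  value at a set that is not dominating: cells of unlisted sets may be read and are never written.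
  Machine numbers are natural, so the terms of the two signs are summed apart and only compared at
  the end.\<close>

lemma superadditive_geom_mean:
  fixes x y :: "'i \<Rightarrow> real"
  assumes "finite J" "J \<noteq> {}" "\<And>i. i \<in> J \<Longrightarrow> x i \<ge> 0" "\<And>i. i \<in> J \<Longrightarrow> y i \<ge> 0"
  shows "(\<Prod>i\<in>J. x i) powr (1 / card J) + (\<Prod>i\<in>J. y i) powr (1 / card J)
    \<le> (\<Prod>i\<in>J. x i + y i) powr (1 / card J)"
proof (cases "\<exists>i\<in>J. x i + y i = 0")
  case True
  then obtain i where i: "i \<in> J" "x i + y i = 0" by blast
  with assms have "x i = 0" "y i = 0" by (metis add_nonneg_eq_0_iff)+
  with i assms have "(\<Prod>i\<in>J. x i) = 0" "(\<Prod>i\<in>J. y i) = 0" by auto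
  then show ?thesis by simp
next
  case False
  define z where "z i = x i + y i" for i
  have z: "z i > 0" if "i \<in> J" for i
    using False assms(3,4)[OF that] that unfolding z_def by force
  define Z where "Z = (\<Prod>i\<in>J. z i) powr (1 / card J)"
  \<comment> \<open>After the geometric mean of \<open>z\<close> is factored out, AM-GM applies to
    the ratios \<open>w i / z i\<close>. It is used for \<open>w = x\<close> and
    \<open>w = y\<close>, whose ratios have arithmetic means adding up to 1.\<close>
  have scale: "(\<Prod>i\<in>J. w i) powr (1 / card J) \<le> Z * (\<Sum>i\<in>J. w i / z i / card J)"
    if w: "\<And>i. i \<in> J \<Longrightarrow> w i \<ge> 0" for w
  proof -
    have "(\<Prod>i\<in>J. w i) = (\<Prod>i\<in>J. z i) * (\<Prod>i\<in>J. w i / z i)"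
      unfolding prod.distrib[symmetric] using z by (intro prod.cong refl) (force)
    then have "(\<Prod>i\<in>J. w i) powr (1 / card J) = Z * (\<Prod>i\<in>J. w i / z i) powr (1 / card J)"
      using z w unfolding Z_def by (subst powr_mult [symmetric]) (auto intro!: prod_nonneg simp: less_imp_le)
    also have "\<dots> \<le> Z * (\<Sum>i\<in>J. w i / z i / card J)"
      using arith_geom_mean[OF assms(1,2), of "\<lambda>i. w i / z i"] w z
      by (intro mult_left_mono) (auto simp: Z_def less_imp_le)
    finally show ?thesis .
  qed
  have "(\<Sum>i\<in>J. x i / z i / card J) + (\<Sum>i\<in>J. y i / z i / card J) = (\<Sum>i\<in>J. 1 / card J)"
    unfolding sum.distrib[symmetric]
  proof (intro sum.cong refl)
    fix i assume "i \<in> J"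
    have "x i / z i / card J + y i / z i / card J = z i / z i / card J"
      by (simp only: add_divide_distrib[symmetric] z_def)
    then show "x i / z i / card J + y i / z i / card J = 1 / card J"
      using z[OF \<open>i \<in> J\<close>] by simp
  qed
  also have "\<dots> = 1" using assms by simp
  finally have "Z * (\<Sum>i\<in>J. x i / z i / card J) + Z * (\<Sum>i\<in>J. y i / z i / card J) = Z"
    by (simp add: distrib_left[symmetric])
  with scale[of x, OF assms(3)] scale[of y, OF assms(4)] show ?thesis
    unfolding Z_def z_def by linarith
qed

text \<open>The superadditivity with roots cleared, shaped as the induction step of Shearer's
  inequality: \<open>a\<close> and \<open>b\<close> will count the sets without and with a chosen
  element, and \<open>p\<close> will collect the projections that do not see this element.\<close>

lemma power_add_le_prod_add:
  fixes x y :: "'i \<Rightarrow> nat"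
  assumes J: "finite J" "J \<noteq> {}"
    and a: "a ^ card J \<le> p * (\<Prod>i\<in>J. x i)" and b: "b ^ card J \<le> p * (\<Prod>i\<in>J. y i)"
  shows "(a + b) ^ card J \<le> p * (\<Prod>i\<in>J. x i + y i)"
proof -
  let ?e = "1 / real (card J)"
  have c: "card J > 0" using J by auto
  have root: "real c \<le> real p powr ?e * (\<Prod>i\<in>J. real (w i)) powr ?e"
    if "c ^ card J \<le> p * (\<Prod>i\<in>J. w i)" for c w
  proof -
    have "real c = (real c ^ card J) powr ?e"
      using c by (cases "c = 0") (auto simp: powr_realpow[symmetric] powr_powr)
    also have "\<dots> \<le> (real p * (\<Prod>i\<in>J. real (w i))) powr ?e"
      using that by (intro powr_mono2) (auto simp flip: of_nat_power of_nat_mult of_nat_prod)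
    finally show ?thesis by (subst (asm) powr_mult) (auto intro: prod_nonneg)
  qed
  have "real (a + b) \<le> real p powr ?e * ((\<Prod>i\<in>J. real (x i)) powr ?e + (\<Prod>i\<in>J. real (y i)) powr ?e)"
    using root[OF a] root[OF b] by (simp add: distrib_left)
  also have "\<dots> \<le> real p powr ?e * (\<Prod>i\<in>J. real (x i) + real (y i)) powr ?e"
    by (intro mult_left_mono superadditive_geom_mean J) auto
  also have "\<dots> = real (p * (\<Prod>i\<in>J. x i + y i)) powr ?e"
    by (simp add: powr_mult prod_nonneg)
  finally have "real (a + b) ^ card J \<le> (real (p * (\<Prod>i\<in>J. x i + y i)) powr ?e) ^ card J"
    by (intro power_mono) auto
  also have "\<dots> = real (p * (\<Prod>i\<in>J. x i + y i))"
    using c by (cases "p * (\<Prod>i\<in>J. x i + y i) = 0") (auto simp: powr_power simp del: of_nat_mult of_nat_prod)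
  finally show ?thesis by (simp only: of_nat_power[symmetric] of_nat_le_iff)
qed

text \<open>Induction on the ground set, splitting the family by membership of the new element
  \<open>v\<close>. Projections to sets without \<open>v\<close> bound both halves at once; in the
  \<delta> projections to sets with \<open>v\<close> the traces of the two halves are disjoint, so
  their numbers add. The geometric mean of these \<delta> factors is superadditive.\<close>

theorem card_power_le_prod_projections:
  assumes "finite V" "finite I" "\<delta> > 0" "F \<subseteq> Pow V"
    and "\<And>v. v \<in> V \<Longrightarrow> card {i \<in> I. v \<in> A i} = \<delta>"
  shows "card F ^ \<delta> \<le> (\<Prod>i\<in>I. card ((\<inter>) (A i) ` F))"
  using assms(1,4,5)
proof (induction V arbitrary: F)
  case empty
  then consider "F = {}" | "F = {{}}" by auto
  \<comment> \<open>For the empty family the right side may be 0, so the left side must not be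
    \<open>0 ^ 0\<close>.\<close>
  then show ?case using \<open>\<delta> > 0\<close> by cases (auto simp: zero_power)
next
  case (insert v V)
  define F0 where "F0 = {X \<in> F. v \<notin> X}"
  define F1 where "F1 = (\<lambda>X. X - {v}) ` {X \<in> F. v \<in> X}"
  define J where "J = {i \<in> I. v \<in> A i}"
  let ?c = "\<lambda>F i. card ((\<inter>) (A i) ` F)"
  have fin: "finite F" using insert by (meson finite_Pow_iff finite_insert finite_subset)
  then have fin01: "finite F0" "finite F1" by (auto simp: F0_def F1_def)
  have J: "card J = \<delta>" "finite J" "J \<subseteq> I" using insert.prems(2)[of v] \<open>finite I\<close> by (auto simp: J_def)
  have Jne: "J \<noteq> {}" using J \<open>\<delta> > 0\<close> by force
  have "F = F0 \<union> {X \<in> F. v \<in> X}" by (auto simp: F0_def)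
  then have "card F = card F0 + card {X \<in> F. v \<in> X}"
    using fin by (subst card_Un_disjoint[symmetric]) (auto simp: F0_def)
  also have "card {X \<in> F. v \<in> X} = card F1"
    unfolding F1_def by (rule card_image[symmetric]) (auto simp: inj_on_def)
  finally have cF: "card F = card F0 + card F1" .
  have IH: "card F' ^ card J \<le> (\<Prod>i\<in>I - J. ?c F i) * (\<Prod>i\<in>J. ?c F' i)"
    if F': "F' \<subseteq> Pow V" and le: "\<And>i. i \<in> I - J \<Longrightarrow> ?c F' i \<le> ?c F i" for F'
  proof -
    have "card F' ^ \<delta> \<le> (\<Prod>i\<in>I. ?c F' i)" using F' by (rule insert.IH) (use insert.prems in auto)
    also have "\<dots> = (\<Prod>i\<in>I - J. ?c F' i) * (\<Prod>i\<in>J. ?c F' i)"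
      using J(3) \<open>finite I\<close> by (rule prod.subset_diff)
    also have "\<dots> \<le> (\<Prod>i\<in>I - J. ?c F i) * (\<Prod>i\<in>J. ?c F' i)"
      by (intro mult_right_mono prod_mono) (use le in auto)
    finally show ?thesis using J by simp
  qed
  have "card F ^ \<delta> \<le> (\<Prod>i\<in>I - J. ?c F i) * (\<Prod>i\<in>J. ?c F0 i + ?c F1 i)"
    unfolding cF J(1)[symmetric]
  proof (rule power_add_le_prod_add[OF J(2) Jne])
    show "card F0 ^ card J \<le> (\<Prod>i\<in>I - J. ?c F i) * (\<Prod>i\<in>J. ?c F0 i)"
      using insert.prems(1) fin by (intro IH) (auto simp: F0_def intro!: card_mono)
    have "(\<inter>) (A i) ` F1 \<subseteq> (\<inter>) (A i) ` F" if "i \<in> I - J" for i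
    proof -
      have "A i \<inter> (X - {v}) = A i \<inter> X" for X using that by (auto simp: J_def)
      then show ?thesis by (auto simp: F1_def)
    qed
    then show "card F1 ^ card J \<le> (\<Prod>i\<in>I - J. ?c F i) * (\<Prod>i\<in>J. ?c F1 i)"
      using insert.prems(1) fin by (intro IH card_mono) (auto simp: F1_def)
  qed
  also have "(\<Prod>i\<in>J. ?c F0 i + ?c F1 i) \<le> (\<Prod>i\<in>J. ?c F i)"
  proof (intro prod_mono conjI)
    fix i assume "i \<in> J"
    then have v: "v \<in> A i" by (simp add: J_def)
    \<comment> \<open>Putting \<open>v\<close> back turns the traces of \<open>F1\<close> into those
      of the members of \<open>F\<close> that contain \<open>v\<close>, and these differ from all
      traces of \<open>F0\<close>.\<close>
    have "card (insert v ` (\<inter>) (A i) ` F1) = ?c F1 i"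
      by (rule card_image) (auto simp: inj_on_def F1_def)
    then have "?c F0 i + ?c F1 i = card ((\<inter>) (A i) ` F0 \<union> insert v ` (\<inter>) (A i) ` F1)"
      using fin01 by (subst card_Un_disjoint) (auto simp: F0_def)
    also have "\<dots> \<le> ?c F i"
    proof (rule card_mono)
      have "insert v (A i \<inter> (X - {v})) = A i \<inter> X" if "v \<in> X" for X using that v by auto
      then show "(\<inter>) (A i) ` F0 \<union> insert v ` (\<inter>) (A i) ` F1 \<subseteq> (\<inter>) (A i) ` F"
        by (auto simp: F0_def F1_def)
    qed (use fin in auto)
    finally show "?c F0 i + ?c F1 i \<le> ?c F i" .
  qed auto
  finally have "card F ^ \<delta> \<le> (\<Prod>i\<in>I - J. ?c F i) * (\<Prod>i\<in>J. ?c F i)" by simp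
  then show ?case using prod.subset_diff[OF J(3) \<open>finite I\<close>, of "?c F"] by simp
qed

section \<open>Dominating sets and their traces on closed neighbourhoods\<close>

definition closed_nbhd :: "'a set set \<Rightarrow> 'a \<Rightarrow> 'a set" where
  "closed_nbhd E v = insert v {u. {u, v} \<in> E}"

definition dominating_sets :: "'a set \<Rightarrow> 'a set set \<Rightarrow> 'a set set" where
  "dominating_sets V E = {X. X \<subseteq> V \<and> (\<forall>v\<in>V. closed_nbhd E v \<inter> X \<noteq> {})}"

lemma closed_nbhd_sym: "u \<in> closed_nbhd E v \<longleftrightarrow> v \<in> closed_nbhd E u"
  by (auto simp: closed_nbhd_def insert_commute)

lemma card_closed_nbhd:
  assumes "simple_graph V E" "v \<in> V"
  shows "closed_nbhd E v \<subseteq> V" "card (closed_nbhd E v) = degree E v + 1"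
proof -
  have E: "e \<subseteq> V" "card e = 2" if "e \<in> E" for e using assms that by (auto simp: simple_graph_def)
  show sub: "closed_nbhd E v \<subseteq> V" using E assms by (force simp: closed_nbhd_def)
  have "finite V" using assms by (simp add: simple_graph_def)
  then have "finite {u. {u, v} \<in> E}" using sub by (auto simp: closed_nbhd_def intro: finite_subset)
  moreover have "v \<notin> {u. {u, v} \<in> E}" using E(2)[of "{v}"] by auto
  ultimately have "card (closed_nbhd E v) = card {u. {u, v} \<in> E} + 1" by (simp add: closed_nbhd_def)
  also have "bij_betw (\<lambda>u. {u, v}) {u. {u, v} \<in> E} {e \<in> E. v \<in> e}"
    unfolding bij_betw_def
  proof
    show "(\<lambda>u. {u, v}) ` {u. {u, v} \<in> E} = {e \<in> E. v \<in> e}"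
    proof (intro equalityI subsetI)
      fix e assume "e \<in> {e \<in> E. v \<in> e}"
      then have "e \<in> E" "v \<in> e" "card e = 2" using E by auto
      then obtain u where "e = {u, v}" by (auto simp: card_2_iff)
      then show "e \<in> (\<lambda>u. {u, v}) ` {u. {u, v} \<in> E}" using \<open>e \<in> E\<close> by auto
    qed auto
  qed (auto simp: inj_on_def doubleton_eq_iff)
  then have "card {u. {u, v} \<in> E} = degree E v" by (simp add: bij_betw_same_card degree_def)
  finally show "card (closed_nbhd E v) = degree E v + 1" .
qed

lemma degree_le_max_degree:
  "finite V \<Longrightarrow> v \<in> V \<Longrightarrow> degree E v \<le> max_degree V E"
  unfolding max_degree_def by (rule Max_ge) auto

text \<open>A vertex of degree less than \<open>\<Delta>\<close> gets additional singletons, so that every vertex lies in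
  exactly \<open>\<Delta> + 1\<close> of the sets to which the family is projected.\<close>

theorem card_dominating_sets_power:
  assumes G: "simple_graph V E"
  shows "card (dominating_sets V E) ^ (max_degree V E + 1) \<le> (2 ^ (max_degree V E + 1) - 1) ^ card V"
proof -
  let ?\<Delta> = "max_degree V E" and ?D = "dominating_sets V E"
  define I where "I = Sigma V (\<lambda>v. {..?\<Delta> - degree E v})"
  define A where "A = (\<lambda>(v, i). if i = (0::nat) then closed_nbhd E v else {v})"
  have fin: "finite V" using G by (simp add: simple_graph_def)
  note deg = degree_le_max_degree[OF fin, of _ E]
  have "card ?D ^ (?\<Delta> + 1) \<le> (\<Prod>i\<in>I. card ((\<inter>) (A i) ` ?D))"
  proof (rule card_power_le_prod_projections[OF fin])
    show "finite I" using fin by (auto simp: I_def)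
    fix u assume u: "u \<in> V"
    \<comment> \<open>Adjacency is symmetric, so the closed neighbourhoods containing
      \<open>u\<close> are those of the members of its own closed neighbourhood; the other indices
      are the singletons added for \<open>u\<close>.\<close>
    have "{i \<in> I. u \<in> A i} = (\<lambda>v. (v, 0)) ` closed_nbhd E u \<union> Pair u ` {1..?\<Delta> - degree E u}"
      using u card_closed_nbhd(1)[OF G u] closed_nbhd_sym[of u E] by (auto simp: I_def A_def split: if_splits)
    also have "card \<dots> = card (closed_nbhd E u) + (?\<Delta> - degree E u)"
      using finite_subset[OF card_closed_nbhd(1)[OF G u] fin]
      by (subst card_Un_disjoint) (auto simp: card_image inj_on_def)
    finally show "card {i \<in> I. u \<in> A i} = ?\<Delta> + 1"
      using card_closed_nbhd(2)[OF G u] deg[OF u] by simp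
  qed (auto simp: dominating_sets_def)
  also have "\<dots> = (\<Prod>v\<in>V. \<Prod>i\<le>?\<Delta> - degree E v. card ((\<inter>) (A (v, i)) ` ?D))"
    unfolding I_def using fin by (subst prod.Sigma) auto
  also have "\<dots> \<le> (\<Prod>v\<in>V. 2 ^ (?\<Delta> + 1) - 1)"
  proof (intro prod_mono conjI)
    fix v assume v: "v \<in> V"
    let ?d = "degree E v"
    have fN: "finite (closed_nbhd E v)" using card_closed_nbhd(1)[OF G v] fin finite_subset by blast
    have "card ((\<inter>) (A (v, 0)) ` ?D) \<le> card (Pow (closed_nbhd E v) - {{}})"
      using v fN by (intro card_mono) (auto simp: A_def dominating_sets_def)
    also have "\<dots> = 2 ^ (?d + 1) - 1"
      using card_closed_nbhd(2)[OF G v] fN by (subst card_Diff_subset) (auto simp: card_Pow)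
    finally have 0: "card ((\<inter>) (A (v, 0)) ` ?D) \<le> 2 ^ (?d + 1) - 1" .
    have 1: "card ((\<inter>) (A (v, Suc i)) ` ?D) \<le> 2" for i
    proof -
      have "card ((\<inter>) (A (v, Suc i)) ` ?D) \<le> card (Pow {v})"
        by (intro card_mono) (auto simp: A_def)
      then show ?thesis by (simp add: card_Pow)
    qed
    have "(\<Prod>i\<le>?\<Delta> - ?d. card ((\<inter>) (A (v, i)) ` ?D))
        = card ((\<inter>) (A (v, 0)) ` ?D) * (\<Prod>i<?\<Delta> - ?d. card ((\<inter>) (A (v, Suc i)) ` ?D))"
      by (rule prod.atMost_shift)
    also have "\<dots> \<le> (2 ^ (?d + 1) - 1) * (\<Prod>i<?\<Delta> - ?d. 2)"
      by (intro mult_mono 0 prod_mono) (auto simp: 1)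
    also have "\<dots> = 2 ^ (?d + 1 + (?\<Delta> - ?d)) - 2 ^ (?\<Delta> - ?d)"
      by (simp add: diff_mult_distrib power_add)
    \<comment> \<open>The padding does no harm: the excluded empty trace, combined with arbitrary
      traces on the singletons, removes \<open>2 ^ (?\<Delta> - ?d)\<close> of the
      \<open>2 ^ (?\<Delta> + 1)\<close> possibilities, hence at least one.\<close>
    also have "\<dots> \<le> 2 ^ (?d + 1 + (?\<Delta> - ?d)) - 1" by (intro diff_le_mono2) simp
    also have "?d + 1 + (?\<Delta> - ?d) = ?\<Delta> + 1" using deg[OF v] by simp
    finally show "(\<Prod>i\<le>?\<Delta> - ?d. card ((\<inter>) (A (v, i)) ` ?D)) \<le> 2 ^ (?\<Delta> + 1) - 1" .
  qed simp
  finally show ?thesis by simp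
qed

corollary card_dominating_sets_le:
  assumes "simple_graph V E"
  shows "real (card (dominating_sets V E))
    \<le> (2 ^ (max_degree V E + 1) - 1) powr (real (card V) / real (max_degree V E + 1))"
proof -
  let ?m = "max_degree V E + 1" and ?N = "card (dominating_sets V E)"
  let ?B = "2 ^ ?m - 1 :: real"
  have B: "?B > 0" by (simp add: one_less_power del: power_Suc)
  have "real ?N ^ ?m \<le> ?B ^ card V"
  proof -
    have "real (?N ^ ?m) \<le> real ((2 ^ ?m - 1) ^ card V)"
      using card_dominating_sets_power[OF assms] of_nat_le_iff by blast
    then show ?thesis by (simp add: of_nat_diff)
  qed
  also have "\<dots> = ?B powr real (card V)" by (rule powr_realpow[OF B, symmetric])
  also have "real (card V) = real ?m * (real (card V) / real ?m)" by simp
  also have "?B powr (real ?m * (real (card V) / real ?m)) = (?B powr (real (card V) / real ?m)) ^ ?m"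
    by (rule powr_power[symmetric]) (use B in simp)
  finally show ?thesis by (rule power_le_imp_le_base[of _ "max_degree V E", unfolded Suc_eq_plus1]) simp
qed

section \<open>Inclusion-exclusion over dominating sets\<close>

text \<open>In a simple graph the independent dominating sets are exactly the maximal independent
  sets; this form has domination built in.\<close>

definition mis :: "'a set \<Rightarrow> 'a set set \<Rightarrow> 'a set set" where
  "mis V E = {X \<in> dominating_sets V E. independent_set V E X}"

definition mis_within :: "'a set \<Rightarrow> 'a set set \<Rightarrow> 'a set \<Rightarrow> nat" where
  "mis_within V E X = card {Y \<in> mis V E. Y \<subseteq> X}"

lemma finite_dominating_sets: "finite V \<Longrightarrow> finite (dominating_sets V E)"
  by (rule finite_subset[of _ "Pow V"]) (auto simp: dominating_sets_def)

lemma dominating_sets_mono: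
  "X \<in> dominating_sets V E \<Longrightarrow> X \<subseteq> Y \<Longrightarrow> Y \<subseteq> V \<Longrightarrow> Y \<in> dominating_sets V E"
  unfolding dominating_sets_def by blast

lemma full_dominating: "V \<in> dominating_sets V E"
  by (auto simp: dominating_sets_def closed_nbhd_def)

text \<open>Take an inclusion-maximal independent superset: a vertex whose closed neighbourhood it
  misses could still be added.\<close>

lemma independent_extends_to_mis:
  assumes "finite V" "simple_graph V E" "independent_set V E S"
  shows "\<exists>X\<in>mis V E. S \<subseteq> X"
proof -
  let ?C = "{X. S \<subseteq> X \<and> independent_set V E X}"
  have "finite ?C" by (rule finite_subset[of _ "Pow V"]) (use assms in \<open>auto simp: independent_set_def\<close>)
  moreover have "?C \<noteq> {}" using assms(3) by auto
  ultimately obtain X where X: "X \<in> ?C" and max: "\<And>Y. Y \<in> ?C \<Longrightarrow> X \<subseteq> Y \<Longrightarrow> X = Y"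
    by (meson finite_has_maximal)
  have "closed_nbhd E v \<inter> X \<noteq> {}" if v: "v \<in> V" for v
  proof
    assume no: "closed_nbhd E v \<inter> X = {}"
    have "{v} \<notin> E" using assms(2) by (auto simp: simple_graph_def)
    moreover have "{v, u} \<notin> E \<and> {u, v} \<notin> E" if "u \<in> X" for u
      using no that unfolding closed_nbhd_def by (auto simp: insert_commute)
    ultimately have "insert v X \<in> ?C" using X v by (auto simp: independent_set_def)
    with max[of "insert v X"] no show False by (auto simp: closed_nbhd_def)
  qed
  with X have "X \<in> mis V E" by (auto simp: mis_def dominating_sets_def independent_set_def)
  with X show ?thesis by blast
qed

text \<open>Enlarging the members of a cover keeps it a cover. Since covers are lists, two members
  may grow into the same set without changing the length.\<close>

lemma coverable_iff_mis:
  assumes "finite V" "simple_graph V E"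
  shows "coverable V E (int k) \<longleftrightarrow> (\<exists>Ss. length Ss = k \<and> set Ss \<subseteq> mis V E \<and> \<Union>(set Ss) = V)"
proof
  assume "coverable V E (int k)"
  then obtain Ss where Ss: "length Ss = k" "\<forall>S\<in>set Ss. independent_set V E S" "\<Union>(set Ss) = V"
    by (auto simp: coverable_def)
  then obtain f where f: "f S \<in> mis V E \<and> S \<subseteq> f S" if "S \<in> set Ss" for S
    using independent_extends_to_mis[OF assms] by metis
  then have "\<Union>(set (map f Ss)) = V"
    using Ss(3) by (fastforce simp: mis_def independent_set_def)
  with f Ss(1) show "\<exists>Ss. length Ss = k \<and> set Ss \<subseteq> mis V E \<and> \<Union>(set Ss) = V"
    by (intro exI[of _ "map f Ss"]) auto
qed (auto simp: coverable_def mis_def)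

text \<open>Singletons suffice, padded with empty sets. This lets the algorithm answer at once when
  \<open>k\<close> is large.\<close>

lemma coverable_of_card_le:
  assumes "finite V" "simple_graph V E" "card V \<le> k"
  shows "coverable V E (int k)"
proof -
  obtain vs where vs: "set vs = V" "distinct vs" using assms(1) finite_distinct_list by blast
  have "\<forall>v. {v} \<notin> E" using assms(2) by (auto simp: simple_graph_def)
  with vs assms(3) show ?thesis unfolding coverable_def
    by (intro exI[of _ "map (\<lambda>v. {v}) vs @ replicate (k - card V) {}"])
       (auto simp: independent_set_def distinct_card)
qed

text \<open>Toggling a fixed vertex outside \<open>T\<close> pairs the supersets with opposite
  signs; only \<open>T = V\<close> leaves no such vertex.\<close>

lemma sum_alternating_supersets:
  assumes "finite V" "T \<subseteq> V"
  shows "(\<Sum>X | T \<subseteq> X \<and> X \<subseteq> V. (-1::int) ^ card X) = (if T = V then (-1) ^ card V else 0)"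
proof (cases "T = V")
  case True
  then have "{X. T \<subseteq> X \<and> X \<subseteq> V} = {V}" by auto
  with True show ?thesis by simp
next
  case False
  then obtain v where v: "v \<in> V" "v \<notin> T" using assms by auto
  define A where "A = {X. T \<subseteq> X \<and> X \<subseteq> V \<and> v \<in> X}"
  define B where "B = {X. T \<subseteq> X \<and> X \<subseteq> V \<and> v \<notin> X}"
  have fin: "finite A" "finite B"
    using assms(1) by (auto simp: A_def B_def intro: finite_subset[of _ "Pow V"])
  have "(\<Sum>X\<in>A. (-1::int) ^ card X) = (\<Sum>X\<in>B. - ((-1) ^ card X))"
  proof (rule sum.reindex_bij_witness[where i = "insert v" and j = "\<lambda>X. X - {v}"])
    fix X assume X: "X \<in> A"
    then have "finite X" using assms(1) finite_subset by (auto simp: A_def)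
    then have "card X = Suc (card (X - {v}))" using X by (simp only: A_def card_Suc_Diff1 mem_Collect_eq)
    then show "- ((-1) ^ card (X - {v})) = (-1::int) ^ card X" by simp
  qed (use v in \<open>auto simp: A_def B_def\<close>)
  moreover have "{X. T \<subseteq> X \<and> X \<subseteq> V} = A \<union> B" by (auto simp: A_def B_def)
  moreover have "A \<inter> B = {}" by (auto simp: A_def B_def)
  ultimately show ?thesis using False fin by (simp add: sum.union_disjoint sum_negf)
qed

text \<open>For \<open>k = 0\<close> the sets that are not dominating would contribute too, as \<open>0 ^ 0 = 1\<close>.\<close>

lemma coverable_iff_alternating_sum:
  assumes "finite V" "simple_graph V E" "k > 0"
  shows "coverable V E (int k) \<longleftrightarrow>
    (\<Sum>X\<in>dominating_sets V E. (-1::int) ^ card X * int (mis_within V E X) ^ k) \<noteq> 0"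
proof -
  let ?M = "mis V E" and ?D = "dominating_sets V E"
  let ?L = "{Ss. set Ss \<subseteq> ?M \<and> length Ss = k}"
  have finD: "finite ?D" using finite_dominating_sets[OF assms(1)] .
  have finM: "finite ?M" using finD by (simp add: mis_def)
  have finL: "finite ?L" using finM by (rule finite_lists_length_eq)
  have sub: "\<Union>(set Ss) \<subseteq> V" if "Ss \<in> ?L" for Ss
    using that by (auto simp: mis_def independent_set_def)
  \<comment> \<open>A set that is not dominating contains no maximal independent set, so extending
    the sum to all subsets adds only terms with factor \<open>0 ^ k\<close>.\<close>
  have "(\<Sum>X\<in>?D. (-1::int) ^ card X * int (mis_within V E X) ^ k)
      = (\<Sum>X\<in>Pow V. (-1::int) ^ card X * int (mis_within V E X) ^ k)"
  proof (rule sum.mono_neutral_left)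
    show "\<forall>X\<in>Pow V - ?D. (-1) ^ card X * int (mis_within V E X) ^ k = 0"
    proof
      fix X assume X: "X \<in> Pow V - ?D"
      then have "{Y \<in> ?M. Y \<subseteq> X} = {}" using dominating_sets_mono[of _ V E X] by (auto simp: mis_def)
      then show "(-1) ^ card X * int (mis_within V E X) ^ k = 0"
        using \<open>k > 0\<close> by (simp only: mis_within_def) simp
    qed
  qed (use assms in \<open>auto simp: dominating_sets_def\<close>)
  \<comment> \<open>The power counts the lists of \<open>k\<close> maximal independent sets inside
    \<open>X\<close>. Once the sums are swapped, the inner sum over \<open>X\<close> vanishes unless
    the list covers \<open>V\<close>.\<close>
  also have "\<dots> = (\<Sum>X\<in>Pow V. \<Sum>Ss\<in>?L. if \<Union>(set Ss) \<subseteq> X then (-1::int) ^ card X else 0)"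
  proof (rule sum.cong[OF refl])
    fix X
    have "mis_within V E X ^ k = card {Ss. set Ss \<subseteq> {Y \<in> ?M. Y \<subseteq> X} \<and> length Ss = k}"
      using finM by (simp add: mis_within_def card_lists_length_eq)
    also have "{Ss. set Ss \<subseteq> {Y \<in> ?M. Y \<subseteq> X} \<and> length Ss = k} = {Ss \<in> ?L. \<Union>(set Ss) \<subseteq> X}" by auto
    finally show "(-1) ^ card X * int (mis_within V E X) ^ k
        = (\<Sum>Ss\<in>?L. if \<Union>(set Ss) \<subseteq> X then (-1::int) ^ card X else 0)"
      using finL by (simp add: sum.If_cases Int_def of_nat_power[symmetric] del: of_nat_power)
  qed
  also have "\<dots> = (\<Sum>Ss\<in>?L. \<Sum>X\<in>Pow V. if \<Union>(set Ss) \<subseteq> X then (-1::int) ^ card X else 0)"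
    by (rule sum.swap)
  also have "\<dots> = (\<Sum>Ss\<in>?L. if \<Union>(set Ss) = V then (-1) ^ card V else 0)"
  proof (rule sum.cong[OF refl])
    fix Ss assume "Ss \<in> ?L"
    have "(\<Sum>X\<in>Pow V. if \<Union>(set Ss) \<subseteq> X then (-1::int) ^ card X else 0)
        = (\<Sum>X | \<Union>(set Ss) \<subseteq> X \<and> X \<subseteq> V. (-1) ^ card X)"
      using assms(1) by (simp add: sum.If_cases Int_def conj_commute)
    with sum_alternating_supersets[OF assms(1) sub[OF \<open>Ss \<in> ?L\<close>]]
    show "(\<Sum>X\<in>Pow V. if \<Union>(set Ss) \<subseteq> X then (-1::int) ^ card X else 0)
        = (if \<Union>(set Ss) = V then (-1) ^ card V else 0)" by simp
  qed
  also have "\<dots> = int (card {Ss \<in> ?L. \<Union>(set Ss) = V}) * (-1) ^ card V"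
    using finL by (simp add: sum.If_cases Int_def)
  \<comment> \<open>All surviving terms have the same sign, so nothing can cancel between different
    covers.\<close>
  finally have "(\<Sum>X\<in>?D. (-1::int) ^ card X * int (mis_within V E X) ^ k)
      = int (card {Ss \<in> ?L. \<Union>(set Ss) = V}) * (-1) ^ card V" .
  moreover have "finite {Ss \<in> ?L. \<Union>(set Ss) = V}" using finL by (rule rev_finite_subset) blast
  ultimately have "(\<Sum>X\<in>?D. (-1::int) ^ card X * int (mis_within V E X) ^ k) \<noteq> 0
      \<longleftrightarrow> {Ss \<in> ?L. \<Union>(set Ss) = V} \<noteq> {}"
    by (simp only: mult_eq_0_iff of_nat_eq_0_iff card_0_eq) simp
  also have "\<dots> \<longleftrightarrow> (\<exists>Ss. length Ss = k \<and> set Ss \<subseteq> mis V E \<and> \<Union>(set Ss) = V)" by blast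
  finally show ?thesis unfolding coverable_iff_mis[OF assms(1,2)] by (rule sym)
qed

text \<open>Step \<open>j\<close> decides whether \<open>j\<close> is kept. A dominating set stays dominating when all undecided
  vertices are added, so no dominating set is missed and the list never shrinks.\<close>

fun dominating_list :: "nat \<Rightarrow> nat set set \<Rightarrow> nat \<Rightarrow> nat set list" where
  "dominating_list n E 0 = [{..<n}]"
| "dominating_list n E (Suc j) = dominating_list n E j @
     filter (\<lambda>X. X \<in> dominating_sets {..<n} E) (map (\<lambda>X. X - {j}) (dominating_list n E j))"

lemma dominating_list:
  assumes "j \<le> n"
  shows "distinct (dominating_list n E j) \<and>
    set (dominating_list n E j) = {X \<in> dominating_sets {..<n} E. {j..<n} \<subseteq> X}"
  using assms
proof (induction j)
  case 0
  then show ?case by (auto simp: full_dominating atLeast0LessThan) (auto simp: dominating_sets_def)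
next
  case (Suc j)
  let ?D = "dominating_sets {..<n} E"
  have IH: "distinct (dominating_list n E j)"
    "set (dominating_list n E j) = {X \<in> ?D. {j..<n} \<subseteq> X}" using Suc by auto
  have j: "j \<in> X" if "X \<in> set (dominating_list n E j)" for X using that IH(2) Suc.prems by auto
  have "inj_on (\<lambda>X. X - {j}) (set (dominating_list n E j))"
    using j by (auto simp: inj_on_def)
  then have "distinct (map (\<lambda>X. X - {j}) (dominating_list n E j))"
    using IH(1) by (simp add: distinct_map)
  moreover have "set (dominating_list n E j) \<inter> set (map (\<lambda>X. X - {j}) (dominating_list n E j)) = {}"
    using j by auto
  ultimately have "distinct (dominating_list n E (Suc j))"
    using IH(1) by (auto intro: distinct_filter)
  moreover have "set (dominating_list n E (Suc j)) = {X \<in> ?D. {Suc j..<n} \<subseteq> X}"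
  proof (intro equalityI subsetI)
    fix X assume "X \<in> set (dominating_list n E (Suc j))"
    then show "X \<in> {X \<in> ?D. {Suc j..<n} \<subseteq> X}" using IH(2) by fastforce
  next
    fix X assume X: "X \<in> {X \<in> ?D. {Suc j..<n} \<subseteq> X}"
    have jn: "{j..<n} = insert j {Suc j..<n}" using Suc.prems by auto
    show "X \<in> set (dominating_list n E (Suc j))"
    proof (cases "j \<in> X")
      case True
      then have "{j..<n} \<subseteq> X" using X jn by auto
      with X IH(2) show ?thesis by simp
    next
      case False
      have "X \<in> ?D" "insert j X \<subseteq> {..<n}" using X Suc.prems by (auto simp: dominating_sets_def)
      then have "insert j X \<in> ?D" by (rule dominating_sets_mono[OF _ subset_insertI])
      moreover have "{j..<n} \<subseteq> insert j X" using X jn by auto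
      ultimately have "insert j X \<in> set (dominating_list n E j)" using IH(2) by simp
      moreover have "X = insert j X - {j}" using False by auto
      ultimately have "X \<in> (\<lambda>X. X - {j}) ` set (dominating_list n E j)" by (rule rev_image_eqI)
      with X show ?thesis by simp
    qed
  qed
  ultimately show ?case by blast
qed

text \<open>Intermediate lists obey the bound as well, so no pass of the listing loop handles more
  sets than the final count.\<close>

lemma length_dominating_list_le:
  assumes "j \<le> n"
  shows "length (dominating_list n E j) \<le> card (dominating_sets {..<n} E)"
proof -
  have "length (dominating_list n E j) = card (set (dominating_list n E j))"
    using dominating_list[OF assms, of E] by (intro distinct_card[symmetric]) blast
  also have "\<dots> \<le> card (dominating_sets {..<n} E)"
    using dominating_list[OF assms, of E] by (intro card_mono finite_dominating_sets) auto
  finally show ?thesis .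
qed

lemma set_dominating_list:
  "distinct (dominating_list n E n)" "set (dominating_list n E n) = dominating_sets {..<n} E"
  using dominating_list[of n n E] by auto

text \<open>The intermediate values of Yates's algorithm for the zeta transform: after
  \<open>j\<close> rounds a counted \<open>Y\<close> may differ from \<open>X\<close> only in
  elements below \<open>j\<close>.\<close>

definition partial_mis_within :: "nat \<Rightarrow> nat set set \<Rightarrow> nat \<Rightarrow> nat set \<Rightarrow> nat" where
  "partial_mis_within n E j X = card {Y \<in> mis {..<n} E. Y \<subseteq> X \<and> X - Y \<subseteq> {..<j}}"

lemma finite_mis: "finite V \<Longrightarrow> finite (mis V E)"
  by (simp add: mis_def finite_dominating_sets)

lemma partial_mis_within_0: "partial_mis_within n E 0 X = of_bool (X \<in> mis {..<n} E)"
proof -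
  have "{Y \<in> mis {..<n} E. Y \<subseteq> X \<and> X - Y \<subseteq> {..<0}} = (if X \<in> mis {..<n} E then {X} else {})"
    by auto
  then show ?thesis by (simp add: partial_mis_within_def)
qed

text \<open>If \<open>j\<close> is in \<open>X\<close>, the sets \<open>Y\<close> containing
  \<open>j\<close> are counted at \<open>X\<close> and the others at \<open>X - {j}\<close>.\<close>

lemma partial_mis_within_Suc:
  "partial_mis_within n E (Suc j) X = partial_mis_within n E j X
    + (if j \<in> X then partial_mis_within n E j (X - {j}) else 0)"
proof (cases "j \<in> X")
  case True
  let ?S = "\<lambda>j X. {Y \<in> mis {..<n} E. Y \<subseteq> X \<and> X - Y \<subseteq> {..<j}}"
  have "Y \<subseteq> X \<and> X - Y \<subseteq> {..<Suc j} \<longleftrightarrow>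
      Y \<subseteq> X \<and> X - Y \<subseteq> {..<j} \<or> Y \<subseteq> X - {j} \<and> X - {j} - Y \<subseteq> {..<j}" for Y
    using True by (cases "j \<in> Y") (auto simp: subset_iff less_Suc_eq)
  then have "?S (Suc j) X = ?S j X \<union> ?S j (X - {j})" by (simp only:) auto
  moreover have "?S j X \<inter> ?S j (X - {j}) = {}" using True by fastforce
  moreover have "finite (?S j Z)" for Z using finite_mis[of "{..<n}" E] by simp
  ultimately have "card (?S (Suc j) X) = card (?S j X) + card (?S j (X - {j}))"
    by (simp only: card_Un_disjoint)
  with True show ?thesis by (simp only: partial_mis_within_def if_True)
next
  case False
  have "{..<Suc j} = insert j {..<j}" by (rule lessThan_Suc)
  with False have "X - Y \<subseteq> {..<Suc j} \<longleftrightarrow> X - Y \<subseteq> {..<j}" for Y by auto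
  with False show ?thesis by (simp only: partial_mis_within_def if_False add_0_right)
qed

text \<open>This makes the restricted transform correct: \<open>X - {j}\<close> may be missing from
  the list, but then its untouched cell already holds the right value.\<close>

lemma partial_mis_within_not_dominating:
  assumes "X \<subseteq> {..<n}" "X \<notin> dominating_sets {..<n} E"
  shows "partial_mis_within n E j X = 0"
proof -
  have "{Y \<in> mis {..<n} E. Y \<subseteq> X \<and> X - Y \<subseteq> {..<j}} = {}"
    using assms dominating_sets_mono[of _ "{..<n}" E X] by (auto simp: mis_def)
  then show ?thesis unfolding partial_mis_within_def by (simp only: card.empty)
qed

lemma partial_mis_within_full:
  "X \<subseteq> {..<n} \<Longrightarrow> partial_mis_within n E n X = mis_within {..<n} E X"
  unfolding partial_mis_within_def mis_within_def by (intro arg_cong[where f = card]) auto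

lemma card_dominating_sets_le_exp: "card (dominating_sets {..<n} E) \<le> 2 ^ n"
proof -
  have "card (dominating_sets {..<n} E) \<le> card (Pow {..<n})"
    by (intro card_mono) (auto simp: dominating_sets_def)
  then show ?thesis by (simp add: card_Pow)
qed

text \<open>Crude, but it keeps every table entry within \<open>n + 1\<close> binary digits.\<close>

lemma partial_mis_within_le: "partial_mis_within n E j X \<le> 2 ^ n"
proof -
  have "partial_mis_within n E j X \<le> card (dominating_sets {..<n} E)"
    unfolding partial_mis_within_def by (intro card_mono) (auto simp: mis_def finite_dominating_sets)
  with card_dominating_sets_le_exp[of n E] show ?thesis by simp
qed

text \<open>Replaces the signed sum by two natural numbers, as the machine has no negative
  values.\<close>

lemma alternating_sum_split:
  fixes f :: "nat set \<Rightarrow> nat"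
  assumes "distinct Xs"
  shows "(\<Sum>X\<in>set Xs. (-1::int) ^ card X * int (f X))
    = int (\<Sum>X\<leftarrow>filter (\<lambda>X. even (card X)) Xs. f X) - int (\<Sum>X\<leftarrow>filter (\<lambda>X. odd (card X)) Xs. f X)"
  using assms by (induction Xs) auto

section \<open>Bounding the running time of programs\<close>

fun expr_size :: "expr \<Rightarrow> nat" where
  "expr_size (Const a) = 1"
| "expr_size (Cell e) = expr_size e + 1"
| "expr_size (Input e) = expr_size e + 1"
| "expr_size (Plus e f) = expr_size e + expr_size f + 1"
| "expr_size (Minus e f) = expr_size e + expr_size f + 1"
| "expr_size (Times e f) = expr_size e + expr_size f + 1"
| "expr_size (Div e f) = expr_size e + expr_size f + 1"

fun small_consts :: "expr \<Rightarrow> bool" where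
  "small_consts (Const a) \<longleftrightarrow> a < 32"
| "small_consts (Cell e) \<longleftrightarrow> small_consts e"
| "small_consts (Input e) \<longleftrightarrow> small_consts e"
| "small_consts (Plus e f) \<longleftrightarrow> small_consts e \<and> small_consts f"
| "small_consts (Minus e f) \<longleftrightarrow> small_consts e \<and> small_consts f"
| "small_consts (Times e f) \<longleftrightarrow> small_consts e \<and> small_consts f"
| "small_consts (Div e f) \<longleftrightarrow> small_consts e \<and> small_consts f"

text \<open>The limits are generous: \<open>32\<close> exceeds every register number and constant of
  the program, \<open>200\<close> the size of each of its expressions. They allow one cost bound to
  serve all expressions.\<close>

definition admissible :: "expr \<Rightarrow> bool" where
  "admissible e \<longleftrightarrow> small_consts e \<and> expr_size e \<le> 200"

definition bounded_mem :: "nat \<Rightarrow> memory \<Rightarrow> bool" where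
  "bounded_mem b m \<longleftrightarrow> (\<forall>a. m a < 2 ^ b)"

lemma len_le: "v < 2 ^ w \<Longrightarrow> 1 \<le> w \<Longrightarrow> len v \<le> w"
  by (simp add: len_def floorlog_leI)

text \<open>The parameter \<open>b\<close> is the word length, to be maintained for every memory
  cell; \<open>5 \<le> b\<close> makes room for all constants below 32.\<close>

locale ram =
  fixes xs :: "nat list" and b :: nat
  assumes b: "5 \<le> b" and input_bound: "x \<in> set xs \<Longrightarrow> x < 2 ^ b"
begin

text \<open>Values inside an expression may outgrow the word length, but only by \<open>b\<close>
  digits per node: a product adds the lengths of its factors, and the one extra digit of a sum fits
  into the allowance of the node itself.\<close>

lemma val_bound:
  assumes "bounded_mem b m" "small_consts e"
  shows "val xs m e < 2 ^ (b * expr_size e)"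
  using assms(2)
proof (induction e)
  case (Const a)
  have "(2::nat) ^ 5 \<le> 2 ^ b" using b by (intro power_increasing) auto
  with Const show ?case by simp
next
  case (Cell e)
  have "m (val xs m e) < 2 ^ b" using assms(1) by (simp add: bounded_mem_def)
  also have "(2::nat) ^ b \<le> 2 ^ (b * expr_size (Cell e))" by (intro power_increasing) auto
  finally show ?case by simp
next
  case (Input e)
  have "val xs m (Input e) < 2 ^ b" using input_bound by auto
  also have "(2::nat) ^ b \<le> 2 ^ (b * expr_size (Input e))" by (intro power_increasing) auto
  finally show ?case .
next
  case (Plus e f)
  let ?x = "2 ^ (b * expr_size e) :: nat" and ?y = "2 ^ (b * expr_size f) :: nat"
  have "?x \<le> ?x * ?y" "?y \<le> ?x * ?y" by simp_all
  then have "?x + ?y \<le> 2 * (?x * ?y)" by linarith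
  also have "\<dots> \<le> 2 ^ b * (?x * ?y)"
    using b self_le_power[of "2::nat" b] by (intro mult_right_mono) auto
  also have "\<dots> = 2 ^ (b * expr_size (Plus e f))" by (simp add: power_add distrib_left)
  finally show ?case using Plus by simp
next
  case (Minus e f)
  have "val xs m e < 2 ^ (b * expr_size e)" using Minus by simp
  also have "(2::nat) ^ (b * expr_size e) \<le> 2 ^ (b * expr_size (Minus e f))"
    by (intro power_increasing) (auto simp: distrib_left)
  finally show ?case by simp
next
  case (Times e f)
  have "val xs m e * val xs m f < 2 ^ (b * expr_size e) * 2 ^ (b * expr_size f)"
    using Times by (intro mult_strict_mono) auto
  also have "\<dots> \<le> 2 ^ (b * expr_size (Times e f))"
    unfolding power_add[symmetric] by (intro power_increasing) (auto simp: distrib_left)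
  finally show ?case by simp
next
  case (Div e f)
  have "val xs m e div val xs m f \<le> val xs m e" by simp
  also have "\<dots> < 2 ^ (b * expr_size e)" using Div by simp
  also have "(2::nat) ^ (b * expr_size e) \<le> 2 ^ (b * expr_size (Div e f))"
    by (intro power_increasing) (auto simp: distrib_left)
  finally show ?case by simp
qed

lemma len_val_le:
  assumes "bounded_mem b m" "small_consts e" "expr_size e \<le> S"
  shows "len (val xs m e) \<le> b * S"
proof -
  have "0 < expr_size e" by (cases e) auto
  then have "len (val xs m e) \<le> b * expr_size e"
    using b by (intro len_le val_bound assms) simp
  also have "\<dots> \<le> b * S" using assms(3) by simp
  finally show ?thesis .
qed

text \<open>Fixing \<open>S\<close> for the whole expression gives all subexpressions the same
  length bound \<open>b * S\<close>, so each node is charged at most twice its square.\<close>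

lemma cost_bound:
  assumes m: "bounded_mem b m" and "small_consts e" "expr_size e \<le> S"
  shows "cost xs m e \<le> expr_size e * (2 * (b * S) ^ 2)"
  using assms(2,3)
proof (induction e)
  case (Const a)
  have "len a \<le> b * S" using len_val_le[OF m Const] by simp
  then show ?case by (simp add: power2_eq_square) (metis le_add1 le_square le_trans mult_2)
next
  case (Cell e)
  have "len (val xs m e) \<le> b * S" "len (val xs m (Cell e)) \<le> b * S"
    using Cell.prems by (intro len_val_le m; simp)+
  moreover have "b * S \<le> (b * S)^2" by (simp add: power2_nat_le_imp_le power2_eq_square)
  ultimately show ?case using Cell by simp
next
  case (Input e)
  have "len (val xs m e) \<le> b * S" "len (val xs m (Input e)) \<le> b * S"
    using Input.prems by (intro len_val_le m; simp)+
  moreover have "b * S \<le> (b * S)^2" by (simp add: power2_nat_le_imp_le power2_eq_square)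
  ultimately show ?case using Input by simp
next
  case (Plus e f)
  have "len (val xs m e) \<le> b * S" "len (val xs m f) \<le> b * S"
    using Plus.prems by (intro len_val_le m; simp)+
  moreover have "b * S \<le> (b * S)^2" by (simp add: power2_nat_le_imp_le power2_eq_square)
  ultimately show ?case using Plus by (simp add: distrib_right)
next
  case (Minus e f)
  have "len (val xs m e) \<le> b * S" "len (val xs m f) \<le> b * S"
    using Minus.prems by (intro len_val_le m; simp)+
  moreover have "b * S \<le> (b * S)^2" by (simp add: power2_nat_le_imp_le power2_eq_square)
  ultimately show ?case using Minus by (simp add: distrib_right)
next
  case (Times e f)
  have "len (val xs m e) \<le> b * S" "len (val xs m f) \<le> b * S"
    using Times.prems by (intro len_val_le m; simp)+
  then have "len (val xs m e) * len (val xs m f) \<le> (b * S)^2"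
    unfolding power2_eq_square by (rule mult_le_mono)
  then show ?case using Times by (simp add: distrib_right)
next
  case (Div e f)
  have "len (val xs m e) \<le> b * S" "len (val xs m f) \<le> b * S"
    using Div.prems by (intro len_val_le m; simp)+
  then have "len (val xs m e) * len (val xs m f) \<le> (b * S)^2"
    unfolding power2_eq_square by (rule mult_le_mono)
  then show ?case using Div by (simp add: distrib_right)
qed

text \<open>Time is counted in units that pay for one assignment or one test.\<close>

definition unit_cost :: nat where "unit_cost = 40000000 * b ^ 2"

lemma cost_admissible:
  assumes "bounded_mem b m" "admissible e"
  shows "cost xs m e + 1 \<le> unit_cost" "2 * cost xs m e + 2 * len (val xs m e) \<le> unit_cost"
proof -
  have e: "small_consts e" "expr_size e \<le> 200" using assms(2) by (auto simp: admissible_def)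
  have "cost xs m e \<le> expr_size e * (2 * (b * 200) ^ 2)" by (rule cost_bound[OF assms(1) e])
  also have "\<dots> \<le> 200 * (2 * (b * 200) ^ 2)" using e by (intro mult_right_mono) auto
  finally have c: "cost xs m e \<le> 16000000 * b ^ 2" by (simp add: power_mult_distrib)
  have l: "len (val xs m e) \<le> b * 200" by (rule len_val_le[OF assms(1) e])
  have bb: "b \<le> b ^ 2" "1 \<le> b" using b by (auto simp: power2_eq_square)
  \<comment> \<open>An assignment evaluates two expressions, each entitled to half a unit; twice
    \<open>16000000 * b ^ 2\<close> plus twice \<open>200 * b\<close> stays below the
    \<open>40000000 * b ^ 2\<close> of a unit.\<close>
  show "cost xs m e + 1 \<le> unit_cost" "2 * cost xs m e + 2 * len (val xs m e) \<le> unit_cost"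
    unfolding unit_cost_def using c l bb by linarith+
qed

text \<open>Total correctness with a time budget for a single start memory; an existential suffices
  because execution is deterministic. Carrying \<open>bounded_mem\<close> along is what keeps the
  unit cost valid for the next command.\<close>

definition runs :: "prog \<Rightarrow> memory \<Rightarrow> nat \<Rightarrow> (memory \<Rightarrow> bool) \<Rightarrow> bool" where
  "runs c m T Q \<longleftrightarrow> (\<exists>t m'. exec xs c m t m' \<and> t \<le> T * unit_cost \<and> bounded_mem b m' \<and> Q m')"

lemma runs_weaken:
  "runs c m T Q \<Longrightarrow> T \<le> T' \<Longrightarrow> (\<And>m'. bounded_mem b m' \<Longrightarrow> Q m' \<Longrightarrow> Q' m') \<Longrightarrow> runs c m T' Q'"
  unfolding runs_def by (meson le_trans mult_le_mono1)

lemma unit_cost_pos: "1 \<le> unit_cost"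
  using b by (simp add: unit_cost_def)

lemma runs_Skip: "bounded_mem b m \<Longrightarrow> Q m \<Longrightarrow> runs Skip m 1 Q"
  unfolding runs_def using exec.Skip unit_cost_pos by fastforce

lemma runs_Assign:
  assumes "bounded_mem b m" "admissible a" "admissible e" "val xs m e < 2 ^ b"
    "Q (m(val xs m a := val xs m e))"
  shows "runs (Assign a e) m 1 Q"
  unfolding runs_def
proof (intro exI conjI)
  show "exec xs (Assign a e) m (cost xs m a + cost xs m e + len (val xs m a) + len (val xs m e))
     (m(val xs m a := val xs m e))" by (rule exec.Assign)
  show "cost xs m a + cost xs m e + len (val xs m a) + len (val xs m e) \<le> 1 * unit_cost"
    using cost_admissible(2)[OF assms(1,2)] cost_admissible(2)[OF assms(1,3)] by linarith
qed (use assms in \<open>auto simp: bounded_mem_def\<close>)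

lemma runs_Seq:
  assumes "runs c m T R" "\<And>m'. bounded_mem b m' \<Longrightarrow> R m' \<Longrightarrow> runs d m' T' Q"
  shows "runs (Seq c d) m (T + T') Q"
proof -
  obtain t m' where 1: "exec xs c m t m'" "t \<le> T * unit_cost" "bounded_mem b m'" "R m'"
    using assms(1) unfolding runs_def by blast
  obtain t' m'' where 2: "exec xs d m' t' m''" "t' \<le> T' * unit_cost" "bounded_mem b m''" "Q m''"
    using assms(2)[OF 1(3,4)] unfolding runs_def by blast
  show ?thesis unfolding runs_def
    using exec.Seq[OF 1(1) 2(1)] 1(2) 2(2-4) by (auto simp: distrib_right intro: add_mono)
qed

lemma runs_If:
  assumes m: "bounded_mem b m" "admissible e"
    and "val xs m e \<noteq> 0 \<Longrightarrow> runs c m T Q" "val xs m e = 0 \<Longrightarrow> runs d m T Q"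
  shows "runs (If e c d) m (T + 1) Q"
proof (cases "val xs m e = 0")
  case True
  then obtain t m' where "exec xs d m t m'" "t \<le> T * unit_cost" "bounded_mem b m'" "Q m'"
    using assms(4) unfolding runs_def by blast
  with exec.IfFalse[OF True, of d t m' c] cost_admissible(1)[OF m] show ?thesis unfolding runs_def
    by (intro exI[of _ "cost xs m e + 1 + t"] exI[of _ m']) auto
next
  case False
  then obtain t m' where "exec xs c m t m'" "t \<le> T * unit_cost" "bounded_mem b m'" "Q m'"
    using assms(3) unfolding runs_def by blast
  with exec.IfTrue[OF False, of c t m' d] cost_admissible(1)[OF m] show ?thesis unfolding runs_def
    by (intro exI[of _ "cost xs m e + 1 + t"] exI[of _ m']) auto
qed

lemma runs_While_False:
  assumes "bounded_mem b m" "admissible e" "val xs m e = 0" "Q m"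
  shows "runs (While e c) m 1 Q"
  unfolding runs_def using exec.WhileFalse[OF assms(3), of c] cost_admissible(1)[OF assms(1,2)] assms
  by (metis mult_1)

lemma runs_While_True:
  assumes "bounded_mem b m" "admissible e" "val xs m e \<noteq> 0" "runs c m T R"
    and "\<And>m'. bounded_mem b m' \<Longrightarrow> R m' \<Longrightarrow> runs (While e c) m' T' Q"
  shows "runs (While e c) m (T + T' + 1) Q"
proof -
  obtain t m' where 1: "exec xs c m t m'" "t \<le> T * unit_cost" "bounded_mem b m'" "R m'"
    using assms(4) unfolding runs_def by blast
  obtain t' m'' where 2: "exec xs (While e c) m' t' m''" "t' \<le> T' * unit_cost" "bounded_mem b m''" "Q m''"
    using assms(5)[OF 1(3,4)] unfolding runs_def by blast
  have "exec xs (While e c) m (cost xs m e + 1 + t + t') m''"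
    by (rule exec.WhileTrue[OF assms(3) 1(1) 2(1)])
  moreover have "cost xs m e + 1 + t + t' \<le> (T + T' + 1) * unit_cost"
    using cost_admissible(1)[OF assms(1,2)] 1(2) 2(2) by (simp add: distrib_right)
  ultimately show ?thesis unfolding runs_def using 2(3,4) by blast
qed

end

abbreviation Var :: "nat \<Rightarrow> expr" where "Var r \<equiv> Cell (Const r)"

text \<open>Truncated subtraction makes \<open>e - i\<close> nonzero exactly while
  \<open>i < e\<close>. The bound \<open>e\<close> is evaluated anew in every round, so the body
  must not change it.\<close>

definition For :: "nat \<Rightarrow> expr \<Rightarrow> prog \<Rightarrow> prog" where
  "For i e c = Seq (Assign (Const i) (Const 0))
     (While (Minus e (Var i)) (Seq c (Assign (Const i) (Plus (Var i) (Const 1)))))"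

definition Accumulate :: "nat \<Rightarrow> nat \<Rightarrow> expr \<Rightarrow> expr \<Rightarrow> expr \<Rightarrow> prog" where
  "Accumulate r i e f g = Seq (Assign (Const r) f) (For i e (Assign (Const r) g))"

context ram
begin

text \<open>Each round pays for the body, the increment and the test; the final 2 covers the
  initialisation and the failing test. The invariant for round \<open>j\<close> speaks of the memory
  whose counter is already \<open>j\<close>, hence the updates at \<open>i\<close> in the
  premises.\<close>

lemma runs_For:
  assumes m: "bounded_mem b m" and i: "i < 32" and e: "admissible (Minus e (Var i))" and N: "N < 2 ^ b"
    and init: "I 0 (m(i := 0))"
    and bound: "\<And>j m. j \<le> N \<Longrightarrow> bounded_mem b m \<Longrightarrow> I j m \<Longrightarrow> m i = j \<Longrightarrow> val xs m e = N"
    and body: "\<And>j m. j < N \<Longrightarrow> bounded_mem b m \<Longrightarrow> I j m \<Longrightarrow> m i = j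
      \<Longrightarrow> runs c m T (\<lambda>m'. m' i = j \<and> I (Suc j) (m'(i := Suc j)))"
    and final: "\<And>m. bounded_mem b m \<Longrightarrow> I N m \<Longrightarrow> m i = N \<Longrightarrow> Q m"
  shows "runs (For i e c) m (N * (T + 2) + 2) Q"
proof -
  let ?inc = "Assign (Const i) (Plus (Var i) (Const 1))"
  let ?w = "While (Minus e (Var i)) (Seq c ?inc)"
  have "runs ?w m ((N - j) * (T + 2) + 1) Q"
    if "bounded_mem b m" "I j m" "m i = j" "j \<le> N" for j m
    using that
  proof (induction "N - j" arbitrary: j m)
    case 0
    then have "j = N" by simp
    then have "runs ?w m 1 Q"
      using 0 bound[of j m] final[of m] by (intro runs_While_False e) auto
    with \<open>j = N\<close> show ?case by simp
  next
    case (Suc d)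
    then have j: "j < N" by simp
    have "runs (Seq c ?inc) m (T + 1) (\<lambda>m'. I (Suc j) m' \<and> m' i = Suc j)"
    proof (rule runs_Seq[OF body[OF j Suc.prems(1-3)]])
      fix m' assume m': "bounded_mem b m'" "m' i = j \<and> I (Suc j) (m'(i := Suc j))"
      show "runs ?inc m' 1 (\<lambda>m'. I (Suc j) m' \<and> m' i = Suc j)"
        using m' i j N by (intro runs_Assign) (auto simp: admissible_def)
    qed
    moreover have "runs ?w m' ((N - Suc j) * (T + 2) + 1) Q"
      if "bounded_mem b m'" "I (Suc j) m' \<and> m' i = Suc j" for m'
      using Suc.hyps(2) j that by (intro Suc.hyps(1)) auto
    moreover have "val xs m (Minus e (Var i)) \<noteq> 0" using bound[of j m] Suc.prems j by simp
    ultimately have "runs ?w m (T + 1 + ((N - Suc j) * (T + 2) + 1) + 1) Q"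
      by (intro runs_While_True[OF Suc.prems(1) e])
    moreover have "T + 1 + ((N - Suc j) * (T + 2) + 1) + 1 \<le> (N - j) * (T + 2) + 1"
    proof -
      have "N - j = Suc (N - Suc j)" using j by simp
      then show ?thesis by (simp only: mult_Suc)
    qed
    ultimately show ?case by (rule runs_weaken)
  qed
  then have w: "runs ?w m' (N * (T + 2) + 1) Q" if "bounded_mem b m'" "I 0 m'" "m' i = 0" for m'
    using that by fastforce
  have "runs (Assign (Const i) (Const 0)) m 1 (\<lambda>m'. I 0 m' \<and> m' i = 0)"
    using i init by (intro runs_Assign m) (auto simp: admissible_def)
  then have "runs (For i e c) m (1 + (N * (T + 2) + 1)) Q"
    unfolding For_def by (rule runs_Seq) (use w in auto)
  then show ?thesis by (rule runs_weaken) auto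
qed

text \<open>A loop that changes only one register besides its counter is described by the successive
  contents \<open>F j\<close> of this register, so the final memory is known exactly and nothing
  else needs to be framed.\<close>

lemma runs_Accumulate:
  assumes m: "bounded_mem b m" and "i < 32" "r < 32" "i \<noteq> r"
    and e: "admissible (Minus e (Var i))" "admissible f" "admissible g"
    and N: "N < 2 ^ b" and F: "\<And>j. j \<le> N \<Longrightarrow> F j < 2 ^ b" and F0: "val xs m f = F 0"
    and bound: "\<And>j. j \<le> N \<Longrightarrow> val xs (m(r := F j, i := j)) e = N"
    and step: "\<And>j. j < N \<Longrightarrow> val xs (m(r := F j, i := j)) g = F (Suc j)"
  shows "runs (Accumulate r i e f g) m (3 * N + 3) (\<lambda>m'. m' = m(r := F N, i := N))"
proof -
  have c: "admissible (Const r)" using assms by (simp add: admissible_def)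
  have "runs (Accumulate r i e f g) m (1 + (N * (1 + 2) + 2)) (\<lambda>m'. m' = m(r := F N, i := N))"
    unfolding Accumulate_def
  proof (rule runs_Seq)
    show "runs (Assign (Const r) f) m 1 (\<lambda>m'. m' = m(r := F 0))"
      using F0 F[of 0] by (intro runs_Assign m c e) auto
    fix m' assume m': "bounded_mem b m'" "m' = m(r := F 0)"
    show "runs (For i e (Assign (Const r) g)) m' (N * (1 + 2) + 2) (\<lambda>m'. m' = m(r := F N, i := N))"
    proof (rule runs_For[where I = "\<lambda>j m'. m' = m(r := F j, i := j)"])
      fix j m' assume j: "j < N" "bounded_mem b m'" "m' = m(r := F j, i := j)"
      show "runs (Assign (Const r) g) m' 1 (\<lambda>m'. m' i = j \<and> m'(i := Suc j) = m(r := F (Suc j), i := Suc j))"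
        using j step[OF j(1)] F[of "Suc j"] \<open>i \<noteq> r\<close>
        by (intro runs_Assign c e) (auto simp: fun_upd_twist)
    qed (use assms m' in auto)
  qed
  then show ?thesis by (rule runs_weaken) auto
qed

end

section \<open>The algorithm\<close>

text \<open>Flattens the nested comprehension of \<open>encode\<close>, so that a matrix cell is
  addressed by quotient and remainder.\<close>

lemma concat_grid:
  "[f u v. u \<leftarrow> [0..<k], v \<leftarrow> [0..<n]] = map (\<lambda>w. f (w div n) (w mod n)) [0..<k * n]"
proof (induction k)
  case (Suc k)
  have "[0..<Suc k * n] = [0..<k * n] @ map (\<lambda>v. v + k * n) [0..<n]"
    using upt_add_eq_append[of 0 "k * n" n] by (simp add: map_add_upt add.commute)
  moreover have "map (\<lambda>w. f (w div n) (w mod n)) (map (\<lambda>v. v + k * n) [0..<n]) = map (f k) [0..<n]"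
    by simp
  ultimately show ?case using Suc by simp
qed simp

text \<open>Beside the registers \<open>0, \<dots>, 15\<close> there are three interleaved arrays: the list of dominating sets
  found so far (\<open>0\<close>), the powers of two (\<open>1\<close>) and the table of the zeta transform (\<open>2\<close>), which is
  indexed by sets. A set of vertices is stored as the number \<^const>\<open>set_encode\<close> assigns to it.
  Register \<open>1\<close> holds \<open>n\<close>, \<open>2\<close> the lowest \<open>n\<close> digits of \<open>k\<close>, \<open>7\<close> the length of the list, \<open>3\<close> to \<open>6\<close> are loop counters,
  \<open>8\<close> to \<open>11\<close> are temporary, and \<open>12\<close> and \<open>13\<close> collect the two signs of the alternating sum.\<close>

definition adr :: "nat \<Rightarrow> nat \<Rightarrow> nat" where "adr a i = 16 + a + 3 * i"

lemma adr_eq_iff: "a < 3 \<Longrightarrow> c < 3 \<Longrightarrow> adr a i = adr c j \<longleftrightarrow> a = c \<and> i = j"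
  unfolding adr_def by presburger

lemma adr_ge: "16 \<le> adr a i"
  by (simp add: adr_def)

lemma adr_neq [simp]:
  "adr a i \<noteq> 0" "adr a i \<noteq> Suc 0" "r < 16 \<Longrightarrow> adr a i \<noteq> r" "r < 16 \<Longrightarrow> r \<noteq> adr a i"
  using adr_ge[of a i] by auto

definition arr :: "nat \<Rightarrow> expr \<Rightarrow> expr" where
  "arr a e = Plus (Const (16 + a)) (Times (Const 3) e)"

text \<open>Bit \<open>u\<close> of \<open>x\<close> as
  \<open>x div 2 ^ u - 2 * (x div 2 ^ (u + 1))\<close>. The machine has neither remainder nor
  exponentiation, so the power is read from array \<open>1\<close>.\<close>

definition member_expr :: "expr \<Rightarrow> expr \<Rightarrow> expr" where
  "member_expr x u = Minus (Div x (Cell (arr 1 u))) (Times (Const 2) (Div x (Times (Const 2) (Cell (arr 1 u)))))"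

lemma val_arr [simp]: "val xs m (arr a e) = adr a (val xs m e)"
  by (simp add: arr_def adr_def)

text \<open>Truncated \<open>1 - x\<close> is how the programs test for zero.\<close>

lemma one_minus_of_bool: "((x::nat) = 0 \<longleftrightarrow> P) \<Longrightarrow> 1 - x = of_bool P"
  by (cases x) auto

lemma mod2_eq: "(x::nat) - 2 * (x div 2) = x mod 2"
  by (simp add: minus_mult_div_eq_mod)

lemma val_member_expr:
  assumes "m (adr 1 (val xs m u)) = 2 ^ val xs m u"
  shows "val xs m (member_expr x u) = of_bool (val xs m u \<in> set_decode (val xs m x))"
proof -
  have "val xs m (member_expr x u) = val xs m x div 2 ^ val xs m u mod 2"
    using assms by (simp add: member_expr_def div_mult2_eq mult.commute[of 2] mod2_eq[simplified mult.commute[of 2]])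
  then show ?thesis by (simp add: set_decode_def mod2_eq_if)
qed

lemma set_encode_Diff: "finite X \<Longrightarrow> j \<in> X \<Longrightarrow> set_encode (X - {j}) = set_encode X - 2 ^ j"
  by (simp add: set_encode_def sum.remove)

lemma set_encode_le: "X \<subseteq> {..<n} \<Longrightarrow> set_encode X < 2 ^ n"
proof -
  assume "X \<subseteq> {..<n}"
  then have "set_encode X \<le> set_encode {..<n}" unfolding set_encode_def by (intro sum_mono2) auto
  also have "\<dots> < 2 ^ n" by (simp add: set_encode_def lessThan_atLeast0 sum_power2)
  finally show ?thesis .
qed

lemma set_encode_full: "set_encode {..<n} = 2 ^ n - 1"
  by (simp add: set_encode_def lessThan_atLeast0 sum_power2)

section \<open>The encoded instance and its word length\<close>

locale instance_graph =
  fixes n :: nat and E :: "nat set set" and k :: int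
  assumes graph: "simple_graph {..<n} E"
begin

definition input where "input = encode n E k"
text \<open>The longest numbers are sums of at most \<open>2 ^ n\<close> powers, each at most
  \<open>2 ^ (n * n)\<close> as its base is at most \<open>2 ^ n\<close> and its exponent at most
  \<open>n\<close>; so \<open>n + n * n\<close> digits and some slack are enough.\<close>

definition width where "width = (n + 1) ^ 2 + 10"
definition cell :: "nat \<Rightarrow> nat" where "cell i = (if i < length input then input ! i else 0)"

lemma input_eq:
  "input = n # map (\<lambda>w. of_bool ({w div n, w mod n} \<in> E)) [0..<n * n] @ of_bool (k < 0) # bits (nat \<bar>k\<bar>) @ [2]"
  unfolding input_def encode_def concat_grid by simp

lemma cell_0: "cell 0 = n"
  by (simp add: cell_def input_eq)

lemma cell_edge: "w < n * n \<Longrightarrow> cell (Suc w) = of_bool ({w div n, w mod n} \<in> E)"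
  by (simp add: cell_def input_eq nth_append)

lemma cell_sign: "cell (Suc (n * n)) = of_bool (k < 0)"
  by (simp add: cell_def input_eq nth_append)

lemma cell_digit: "cell (n * n + 2 + i) =
    (if i < floorlog 2 (nat \<bar>k\<bar>) then nat \<bar>k\<bar> div 2 ^ i mod 2 else if i = floorlog 2 (nat \<bar>k\<bar>) then 2 else 0)"
proof -
  have "n * n + 2 + i = Suc (length (map (\<lambda>w. of_bool ({w div n, w mod n} \<in> E) :: nat) [0..<n * n]) + Suc i)"
    by simp
  then have "cell (n * n + 2 + i) = (if i < Suc (floorlog 2 (nat \<bar>k\<bar>)) then (bits (nat \<bar>k\<bar>) @ [2]) ! i else 0)"
    unfolding cell_def input_eq by (simp add: nth_append bits_def)
  then show ?thesis by (auto simp: bits_def nth_append)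
qed

lemma le_width: "x \<le> width \<Longrightarrow> x < 2 ^ width"
  using less_exp[of width] by linarith

lemma counters_le_width: "n \<le> width" "Suc n \<le> width" "n * n \<le> width" "2 * n \<le> width"
  by (auto simp: width_def power2_eq_square)

lemma le_exp_width: "(x::nat) \<le> 2 ^ e \<Longrightarrow> e \<le> n + n * n \<Longrightarrow> x < 2 ^ width"
proof -
  assume *: "x \<le> 2 ^ e" "e \<le> n + n * n"
  then have "(2::nat) ^ e < 2 ^ width"
    by (intro power_strict_increasing) (auto simp: width_def power2_eq_square)
  with * show ?thesis by linarith
qed

sublocale ram input width
proof
  fix x assume "x \<in> set input"
  then have "x \<le> width"
    using counters_le_width(1) by (auto simp: input_eq bits_def width_def)
  then show "x < 2 ^ width" by (rule le_width)
qed (simp add: width_def)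

lemma val_Input [simp]: "val input m (Input e) = cell (val input m e)"
  by (simp add: cell_def)

declare val.simps(3) [simp del]

definition powers :: "memory \<Rightarrow> bool" where
  "powers m \<longleftrightarrow> m 1 = n \<and> (\<forall>u\<le>n. m (adr 1 u) = 2 ^ u)"

end

lemmas admissible_simps = admissible_def member_expr_def arr_def

text \<open>The term \<open>1 - ((u - v) + (v - u))\<close> tests \<open>u = v\<close> by truncated
  subtraction. It supplies the diagonal of the adjacency matrix, turning neighbourhoods into closed
  ones.\<close>

definition nbhd_count :: expr where
  "nbhd_count = Plus (Var 10) (Times (member_expr (Var 9) (Var 3))
    (Plus (Input (Plus (Const 1) (Plus (Times (Var 4) (Var 1)) (Var 3))))
      (Minus (Const 1) (Plus (Minus (Var 3) (Var 4)) (Minus (Var 4) (Var 3))))))"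

definition undominated_prog :: prog where
  "undominated_prog = Seq (Assign (Const 11) (Const 0)) (For 4 (Var 1)
    (Seq (Accumulate 10 3 (Var 1) (Const 0) nbhd_count) (Assign (Const 11) (Plus (Var 11) (Minus (Const 1) (Var 10))))))"

context instance_graph
begin

lemma cell_edge2: "u < n \<Longrightarrow> v < n \<Longrightarrow> cell (Suc (v * n + u)) = of_bool ({u, v} \<in> E)"
proof -
  assume uv: "u < n" "v < n"
  then have "v * n + u < Suc v * n" by simp
  also have "\<dots> \<le> n * n" using uv by (intro mult_le_mono) auto
  finally show ?thesis using uv cell_edge[of "v * n + u"] by (simp add: insert_commute)
qed

lemma runs_undominated:
  assumes m: "bounded_mem width m" "powers m" "m 9 = set_encode X" "X \<subseteq> {..<n}"
  shows "runs undominated_prog m (n * (3 * n + 6) + 3)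
    (\<lambda>m'. (\<forall>a. a \<notin> {3, 4, 10, 11} \<longrightarrow> m' a = m a) \<and> (m' 11 = 0 \<longleftrightarrow> X \<in> dominating_sets {..<n} E))"
proof -
  let ?bad = "\<lambda>j. \<Sum>v<j. of_bool (closed_nbhd E v \<inter> X = {}) :: nat"
  let ?I = "\<lambda>j m'. (\<forall>a. a \<notin> {3, 4, 10, 11} \<longrightarrow> m' a = m a) \<and> m' 11 = ?bad j"
  have bad: "?bad j \<le> j" for j
    using sum_bounded_above[of "{..<j}" "\<lambda>v. of_bool (closed_nbhd E v \<inter> X = {})" "1::nat"] by simp
  have finX: "finite X" using m(4) finite_subset by blast
  have "runs undominated_prog m (1 + (n * ((3 * n + 3 + 1) + 2) + 2)) (?I n)"
    unfolding undominated_prog_def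
  proof (rule runs_Seq)
    show "runs (Assign (Const 11) (Const 0)) m 1 (?I 0)"
      by (intro runs_Assign m) (auto simp: admissible_simps)
  next
    fix m1 assume m1: "bounded_mem width m1" "?I 0 m1"
    show "runs (For 4 (Var 1) (Seq (Accumulate 10 3 (Var 1) (Const 0) nbhd_count) (Assign (Const 11) (Plus (Var 11) (Minus (Const 1) (Var 10)))))) m1 (n * ((3 * n + 3 + 1) + 2) + 2) (?I n)"
    proof (rule runs_For[where I = ?I])
      fix v m2 assume v: "v < n" and m2: "bounded_mem width m2" "?I v m2" "m2 4 = v"
      let ?F = "\<lambda>j. \<Sum>u<j. of_bool (u \<in> X) * (of_bool ({u, v} \<in> E) + of_bool (u = v)) :: nat"
      have F_le: "?F j \<le> 2 * j" for j
        using sum_bounded_above[of "{..<j}" "\<lambda>u. of_bool (u \<in> X) * (of_bool ({u, v} \<in> E) + of_bool (u = v))" "2::nat"]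
        by (simp add: mult.commute)
      have F0: "?F n = 0 \<longleftrightarrow> closed_nbhd E v \<inter> X = {}"
        using m(4) by (auto simp: closed_nbhd_def)
      show "runs (Seq (Accumulate 10 3 (Var 1) (Const 0) nbhd_count) (Assign (Const 11) (Plus (Var 11) (Minus (Const 1) (Var 10))))) m2 (3 * n + 3 + 1)
        (\<lambda>m'. m' 4 = v \<and> ?I (Suc v) (m'(4 := Suc v)))"
      proof (rule runs_Seq)
        show "runs (Accumulate 10 3 (Var 1) (Const 0) nbhd_count) m2 (3 * n + 3)
          (\<lambda>m'. m' = m2(10 := ?F n, 3 := n))"
        proof (rule runs_Accumulate)
          fix j assume j: "j < n"
          have "(m2(10 := ?F j, 3 := j)) (adr 1 j) = 2 ^ j" "m2 1 = n"
            using m2 m(2) j by (auto simp: powers_def)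
          then show "val input (m2(10 := ?F j, 3 := j))
            nbhd_count = ?F (Suc j)"
            using j v m2 m(3) finX by (simp add: nbhd_count_def val_member_expr cell_edge2)
        next
          fix j assume "j \<le> n"
          then show "?F j < 2 ^ width" using F_le[of j] counters_le_width by (intro le_width) linarith
        next
          show "n < 2 ^ width" by (rule le_width[OF counters_le_width(1)])
        qed (use m2 m(2) in \<open>auto simp: admissible_simps powers_def nbhd_count_def\<close>)
      next
        fix m3 assume m3: "bounded_mem width m3" "m3 = m2(10 := ?F n, 3 := n)"
        have "?bad (Suc v) < 2 ^ width"
          using bad[of "Suc v"] v counters_le_width(2) by (intro le_width) linarith
        moreover have "1 - ?F n = of_bool (closed_nbhd E v \<inter> X = {})"
          by (rule one_minus_of_bool[OF F0])
        ultimately show "runs (Assign (Const 11) (Plus (Var 11) (Minus (Const 1) (Var 10)))) m3 1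
          (\<lambda>m'. m' 4 = v \<and> ?I (Suc v) (m'(4 := Suc v)))"
          using m2 m3 by (intro runs_Assign) (auto simp: admissible_simps)
      qed
    next
      show "n < 2 ^ width" by (rule le_width[OF counters_le_width(1)])
    qed (use m m1 in \<open>auto simp: admissible_simps powers_def\<close>)
  qed
  then show ?thesis
  proof (rule runs_weaken)
    fix m' assume "?I n m'"
    moreover have "?bad n = 0 \<longleftrightarrow> X \<in> dominating_sets {..<n} E"
      using m(4) by (auto simp: dominating_sets_def)
    ultimately show "(\<forall>a. a \<notin> {3, 4, 10, 11} \<longrightarrow> m' a = m a) \<and> (m' 11 = 0 \<longleftrightarrow> X \<in> dominating_sets {..<n} E)"
      by simp
  qed simp
qed

end

section \<open>Programs for the list, the zeta transform and the alternating sum\<close>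

lemma adr_eq [simp]: "adr a i = adr a j \<longleftrightarrow> i = j"
  by (simp add: adr_def)

lemma small_consts_arr [simp]: "small_consts (arr a e) \<longleftrightarrow> a < 16 \<and> small_consts e"
  by (auto simp: arr_def)

lemma expr_size_arr [simp]: "expr_size (arr a e) = expr_size e + 4"
  by (simp add: arr_def)

lemma small_consts_member [simp]:
  "small_consts (member_expr x u) \<longleftrightarrow> small_consts x \<and> small_consts u"
  by (auto simp: member_expr_def)

lemma expr_size_member [simp]:
  "expr_size (member_expr x u) = 2 * expr_size x + 2 * expr_size u + 17"
  by (simp add: member_expr_def)

text \<open>All sets listed before the current pass contain its vertex \<open>j\<close>, so
  subtracting \<open>2 ^ j\<close> deletes it.\<close>

definition list_step :: prog where
  "list_step = Seq (Assign (Const 9) (Minus (Cell (arr 0 (Var 6))) (Cell (arr 1 (Var 5)))))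
    (Seq undominated_prog
      (If (Var 11) Skip
        (Seq (Assign (arr 0 (Var 7)) (Var 9)) (Assign (Const 7) (Plus (Var 7) (Const 1))))))"

text \<open>Register \<open>8\<close> freezes the length before a pass, because register
  \<open>7\<close> grows during the pass and the new sets must not be visited in it.\<close>

definition list_prog :: prog where
  "list_prog = Seq (Assign (arr 0 (Const 0)) (Minus (Cell (arr 1 (Var 1))) (Const 1)))
    (Seq (Assign (Const 7) (Const 1))
      (For 5 (Var 1) (Seq (Assign (Const 8) (Var 7)) (For 6 (Var 8) list_step))))"

definition edge_count :: expr where
  "edge_count = Plus (Var 10) (Times
    (Times (member_expr (Cell (arr 0 (Var 6))) (Div (Var 3) (Var 1)))
      (member_expr (Cell (arr 0 (Var 6))) (Minus (Var 3) (Times (Var 1) (Div (Var 3) (Var 1))))))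
    (Input (Plus (Const 1) (Var 3))))"

text \<open>Only listed sets are visited. They are dominating, so having no inner edge is all that
  remains to be tested.\<close>

definition mis_prog :: prog where
  "mis_prog = For 6 (Var 7) (Seq (Accumulate 10 3 (Times (Var 1) (Var 1)) (Const 0) edge_count)
    (Assign (arr 2 (Cell (arr 0 (Var 6)))) (Minus (Const 1) (Var 10))))"

text \<open>If \<open>j\<close> is not in the set, the last subtraction gives a meaningless address,
  but what is read there is multiplied by 0.\<close>

definition zeta_term :: expr where
  "zeta_term = Plus (Cell (arr 2 (Cell (arr 0 (Var 6)))))
    (Times (member_expr (Cell (arr 0 (Var 6))) (Var 5))
      (Cell (arr 2 (Minus (Cell (arr 0 (Var 6))) (Cell (arr 1 (Var 5)))))))"

definition zeta_prog :: prog where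
  "zeta_prog = For 5 (Var 1) (For 6 (Var 7) (Assign (arr 2 (Cell (arr 0 (Var 6)))) zeta_term))"

definition mod2 :: "expr \<Rightarrow> expr" where
  "mod2 e = Minus e (Times (Const 2) (Div e (Const 2)))"

lemma val_mod2 [simp]: "val xs m (mod2 e) = val xs m e mod 2"
  by (simp add: mod2_def mod2_eq)

text \<open>The sign is handled by indirect addressing: the parity of the cardinality selects
  register \<open>12\<close> or \<open>13\<close>.\<close>

definition sum_step :: prog where
  "sum_step = Seq (Accumulate 10 3 (Var 2) (Const 1) (Times (Var 10) (Cell (arr 2 (Cell (arr 0 (Var 6)))))))
    (Seq (Accumulate 11 3 (Var 1) (Const 0) (Plus (Var 11) (member_expr (Cell (arr 0 (Var 6))) (Var 3))))
      (Assign (Plus (Const 12) (mod2 (Var 11))) (Plus (Cell (Plus (Const 12) (mod2 (Var 11)))) (Var 10))))"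

definition sum_prog :: prog where
  "sum_prog = Seq (Assign (Const 12) (Const 0)) (Seq (Assign (Const 13) (Const 0)) (For 6 (Var 7) sum_step))"

section \<open>Memory invariants and correctness of the phases\<close>

context instance_graph
begin

definition colours :: nat where "colours = nat \<bar>k\<bar> mod 2 ^ n"

definition ready :: "memory \<Rightarrow> bool" where
  "ready m \<longleftrightarrow> powers m \<and> m 2 = colours"

definition listed :: "memory \<Rightarrow> nat set list \<Rightarrow> bool" where
  "listed m Xs \<longleftrightarrow> (\<forall>i<length Xs. m (adr 0 i) = set_encode (Xs ! i))"

text \<open>All subsets are included, even those never listed, because the transform also reads
  their cells.\<close>

definition table :: "memory \<Rightarrow> (nat set \<Rightarrow> nat) \<Rightarrow> bool" where
  "table m f \<longleftrightarrow> (\<forall>X\<subseteq>{..<n}. m (adr 2 (set_encode X)) = f X)"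

lemma ready_upd [simp]:
  "r < 16 \<Longrightarrow> r \<noteq> 1 \<Longrightarrow> r \<noteq> 2 \<Longrightarrow> ready (m(r := v)) = ready m"
  "ready (m(adr 0 i := v)) = ready m"
  "ready (m(adr 2 i := v)) = ready m"
  by (simp_all add: ready_def powers_def adr_eq_iff)

lemma listed_upd [simp]:
  "r < 16 \<Longrightarrow> listed (m(r := v)) Xs = listed m Xs"
  "listed (m(adr 2 i := v)) Xs = listed m Xs"
  by (simp_all add: listed_def adr_eq_iff)

lemma table_upd [simp]:
  "r < 16 \<Longrightarrow> table (m(r := v)) f = table m f"
  "table (m(adr 0 i := v)) f = table m f"
  by (simp_all add: table_def adr_eq_iff)

lemma table_fun_upd:
  assumes "table m f" "X \<subseteq> {..<n}" "\<And>Y. Y \<subseteq> {..<n} \<Longrightarrow> Y \<noteq> X \<Longrightarrow> g Y = f Y" "v = g X"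
  shows "table (m(adr 2 (set_encode X) := v)) g"
  using assms unfolding table_def by (auto simp: set_encode_eq finite_subset)

lemma listed_append:
  "listed m Xs \<Longrightarrow> listed (m(adr 0 (length Xs) := set_encode X)) (Xs @ [X])"
  by (auto simp: listed_def nth_append)

lemma ready_powers: "ready m \<Longrightarrow> powers m" by (simp add: ready_def)

lemma ready_simps [simp]:
  assumes "ready m"
  shows "m (Suc 0) = n" "m 2 = colours" "u \<le> n \<Longrightarrow> m (adr (Suc 0) u) = 2 ^ u"
  using assms by (auto simp: ready_def powers_def)

lemma frame_undominated:
  assumes "\<forall>a. a \<notin> {3, 4, 10, 11} \<longrightarrow> m' a = m a"
  shows "ready m' = ready m" "listed m' Xs = listed m Xs" "table m' f = table m f"
proof -
  have "m' 1 = m 1" "m' 2 = m 2" "\<And>c i. m' (adr c i) = m (adr c i)"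
    using assms by simp_all
  then show "ready m' = ready m" "listed m' Xs = listed m Xs" "table m' f = table m f"
    by (simp_all only: ready_def powers_def listed_def table_def)
qed

abbreviation "D \<equiv> dominating_sets {..<n} E"

lemma D_le_width: "x \<le> card D \<Longrightarrow> x < 2 ^ width"
  using card_dominating_sets_le_exp[of n E] by (intro le_exp_width[of x n]) auto

lemma runs_list:
  assumes m: "bounded_mem width m" "ready m" "table m f"
  shows "runs list_prog m (n * (card D * (n * (3 * n + 6) + 9) + 5) + 4)
    (\<lambda>m'. ready m' \<and> table m' f \<and> listed m' (dominating_list n E n) \<and> m' 7 = length (dominating_list n E n))"
proof -
  let ?L = "dominating_list n E"
  let ?base = "\<lambda>m. ready m \<and> table m f"
  let ?I = "\<lambda>j m'. ?base m' \<and> listed m' (?L j) \<and> m' 7 = length (?L j)"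
  have len: "length (?L j) < 2 ^ width" if "j \<le> n" for j
    by (rule D_le_width[OF length_dominating_list_le[OF that]])
  \<comment> \<open>The time is first written in the shape of the program, so that the rules match
    it literally; it is simplified only at the end.\<close>
  have "runs list_prog m (1 + (1 + (n * ((1 + (card D * ((1 + ((n * (3 * n + 6) + 3) + (2 + 1))) + 2) + 2)) + 2) + 2))) (?I n)"
    unfolding list_prog_def
  proof (rule runs_Seq)
    show "runs (Assign (arr 0 (Const 0)) (Minus (Cell (arr 1 (Var 1))) (Const 1))) m 1
      (\<lambda>m'. ?base m' \<and> listed m' (?L 0))"
    proof (rule runs_Assign)
      have "(2::nat) ^ n - 1 < 2 ^ width" using le_exp_width[of "2 ^ n - 1" n] by simp
      then show "val input m (Minus (Cell (arr 1 (Var 1))) (Const 1)) < 2 ^ width"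
        using m(2) by simp
    qed (use m in \<open>auto simp: admissible_def listed_def set_encode_full\<close>)
  next
    fix m1 assume m1: "bounded_mem width m1" "?base m1 \<and> listed m1 (?L 0)"
    show "runs (Seq (Assign (Const 7) (Const 1)) (For 5 (Var 1) (Seq (Assign (Const 8) (Var 7)) (For 6 (Var 8) list_step)))) m1
      (1 + (n * ((1 + (card D * ((1 + ((n * (3 * n + 6) + 3) + (2 + 1))) + 2) + 2)) + 2) + 2)) (?I n)"
    proof (rule runs_Seq)
      show "runs (Assign (Const 7) (Const 1)) m1 1 (?I 0)"
        using m1 le_width[of 1] b by (intro runs_Assign) (auto simp: admissible_def)
    next
      fix m2 assume m2: "bounded_mem width m2" "?I 0 m2"
      show "runs (For 5 (Var 1) (Seq (Assign (Const 8) (Var 7)) (For 6 (Var 8) list_step))) m2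
        (n * ((1 + (card D * ((1 + ((n * (3 * n + 6) + 3) + (2 + 1))) + 2) + 2)) + 2) + 2) (?I n)"
      proof (rule runs_For[where I = ?I])
        fix j m3 assume j: "j < n" and m3: "bounded_mem width m3" "?I j m3" "m3 5 = j"
        \<comment> \<open>The list in the middle of a pass, after \<open>i\<close> of the old sets.
          New sets are appended behind, so the old ones can still be read at their
          positions.\<close>
        define cur where "cur i = ?L j @ filter (\<lambda>X. X \<in> D) (map (\<lambda>X. X - {j}) (take i (?L j)))" for i
        have cur_0: "cur 0 = ?L j" and cur_end: "cur (length (?L j)) = ?L (Suc j)"
          by (simp_all add: cur_def)
        have cur_Suc: "cur (Suc i) = cur i @ (if ?L j ! i - {j} \<in> D then [?L j ! i - {j}] else [])"
          and cur_nth: "i < length (cur i)" "cur i ! i = ?L j ! i" if "i < length (?L j)" for i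
          using that by (simp_all add: cur_def take_Suc_conv_app_nth nth_append)
        \<comment> \<open>The growing list never exceeds the result of the pass, which keeps
          register \<open>7\<close> within the word length.\<close>
        have cur_le: "length (cur i) \<le> length (?L (Suc j))" for i
        proof -
          have "map (\<lambda>X. X - {j}) (?L j) = map (\<lambda>X. X - {j}) (take i (?L j)) @ map (\<lambda>X. X - {j}) (drop i (?L j))"
            by (simp flip: map_append)
          then show ?thesis by (simp add: cur_def)
        qed
        let ?J = "\<lambda>i m'. ?base m' \<and> m' 5 = j \<and> m' 8 = length (?L j) \<and> listed m' (cur i) \<and> m' 7 = length (cur i)"
        show "runs (Seq (Assign (Const 8) (Var 7)) (For 6 (Var 8) list_step)) m3
          (1 + (card D * ((1 + ((n * (3 * n + 6) + 3) + (2 + 1))) + 2) + 2))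
          (\<lambda>m'. m' 5 = j \<and> ?I (Suc j) (m'(5 := Suc j)))"
        proof (rule runs_Seq)
          show "runs (Assign (Const 8) (Var 7)) m3 1 (?J 0)"
            using m3 len[of j] j by (intro runs_Assign) (auto simp: admissible_def cur_0)
        next
          fix m4 assume m4: "bounded_mem width m4" "?J 0 m4"
          have "runs (For 6 (Var 8) list_step) m4
            (length (?L j) * ((1 + ((n * (3 * n + 6) + 3) + (2 + 1))) + 2) + 2)
            (\<lambda>m'. m' 5 = j \<and> ?I (Suc j) (m'(5 := Suc j)))"
          proof (rule runs_For[where I = ?J])
            fix i m5 assume i: "i < length (?L j)" and m5: "bounded_mem width m5" "?J i m5" "m5 6 = i"
            define X where "X = ?L j ! i"
            have "X \<in> set (?L j)" using i by (simp add: X_def)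
            then have X: "X \<subseteq> {..<n}" "j \<in> X"
              using dominating_list[of j n E] j by (auto simp: dominating_sets_def)
            have finX: "finite X" using X(1) finite_subset by blast
            have Xi: "m5 (adr 0 i) = set_encode X"
              using m5(2) cur_nth[OF i] by (simp add: listed_def X_def)
            have code: "set_encode X - 2 ^ j = set_encode (X - {j})"
              using set_encode_Diff[OF finX X(2)] by simp
            have code_less: "set_encode (X - {j}) < 2 ^ width"
            proof (rule le_exp_width[of _ n])
              have "X - {j} \<subseteq> {..<n}" using X(1) by auto
              then show "set_encode (X - {j}) \<le> 2 ^ n" using set_encode_le by (simp add: less_imp_le)
            qed simp
            show "runs list_step m5 (1 + ((n * (3 * n + 6) + 3) + (2 + 1)))
              (\<lambda>m'. m' 6 = i \<and> ?J (Suc i) (m'(6 := Suc i)))"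
              unfolding list_step_def
            proof (rule runs_Seq)
              show "runs (Assign (Const 9) (Minus (Cell (arr 0 (Var 6))) (Cell (arr 1 (Var 5))))) m5 1
                (\<lambda>m'. ?J i m' \<and> m' 6 = i \<and> m' 9 = set_encode (X - {j}))"
                using m5 Xi j code_less
                by (intro runs_Assign) (simp_all add: admissible_def code)
            next
              fix m6 assume m6: "bounded_mem width m6" "?J i m6 \<and> m6 6 = i \<and> m6 9 = set_encode (X - {j})"
              show "runs (Seq undominated_prog (If (Var 11) Skip
                (Seq (Assign (arr 0 (Var 7)) (Var 9)) (Assign (Const 7) (Plus (Var 7) (Const 1)))))) m6
                ((n * (3 * n + 6) + 3) + (2 + 1)) (\<lambda>m'. m' 6 = i \<and> ?J (Suc i) (m'(6 := Suc i)))"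
              proof (rule runs_Seq[OF runs_undominated[of m6 "X - {j}"]])
                fix m7 assume m7: "bounded_mem width m7"
                  "(\<forall>a. a \<notin> {3, 4, 10, 11} \<longrightarrow> m7 a = m6 a) \<and> (m7 11 = 0 \<longleftrightarrow> X - {j} \<in> D)"
                then have J7: "?J i m7" "m7 6 = i" "m7 9 = set_encode (X - {j})"
                  using m6(2) frame_undominated[of m7 m6] by auto
                show "runs (If (Var 11) Skip
                  (Seq (Assign (arr 0 (Var 7)) (Var 9)) (Assign (Const 7) (Plus (Var 7) (Const 1))))) m7
                  (2 + 1) (\<lambda>m'. m' 6 = i \<and> ?J (Suc i) (m'(6 := Suc i)))"
                proof (rule runs_If)
                  assume "val input m7 (Var 11) \<noteq> 0"
                  then have "cur (Suc i) = cur i" using m7(2) cur_Suc[OF i] by (simp add: X_def)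
                  with J7 have "runs Skip m7 1 (\<lambda>m'. m' 6 = i \<and> ?J (Suc i) (m'(6 := Suc i)))"
                    by (intro runs_Skip m7) (simp only: listed_upd table_upd ready_upd, simp)
                  then show "runs Skip m7 2 (\<lambda>m'. m' 6 = i \<and> ?J (Suc i) (m'(6 := Suc i)))"
                    by (rule runs_weaken) auto
                next
                  assume "val input m7 (Var 11) = 0"
                  then have cS: "cur (Suc i) = cur i @ [X - {j}]"
                    using m7(2) cur_Suc[OF i] by (simp add: X_def)
                  have "runs (Seq (Assign (arr 0 (Var 7)) (Var 9)) (Assign (Const 7) (Plus (Var 7) (Const 1)))) m7 (1 + 1)
                    (\<lambda>m'. m' 6 = i \<and> ?J (Suc i) (m'(6 := Suc i)))"
                  proof (rule runs_Seq)
                    show "runs (Assign (arr 0 (Var 7)) (Var 9)) m7 1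
                      (\<lambda>m'. ?base m' \<and> m' 5 = j \<and> m' 6 = i \<and> m' 8 = length (?L j)
                        \<and> listed m' (cur (Suc i)) \<and> m' 7 = length (cur i))"
                      using J7 code_less listed_append[of m7 "cur i" "X - {j}"]
                      by (intro runs_Assign m7) (auto simp: admissible_def cS)
                  next
                    fix m8 assume m8: "bounded_mem width m8" "?base m8 \<and> m8 5 = j \<and> m8 6 = i \<and> m8 8 = length (?L j)
                        \<and> listed m8 (cur (Suc i)) \<and> m8 7 = length (cur i)"
                    have "length (cur (Suc i)) < 2 ^ width"
                      using cur_le[of "Suc i"] len[of "Suc j"] j by linarith
                    then show "runs (Assign (Const 7) (Plus (Var 7) (Const 1))) m8 1
                      (\<lambda>m'. m' 6 = i \<and> ?J (Suc i) (m'(6 := Suc i)))"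
                      using m8 unfolding cS by (intro runs_Assign) (auto simp: admissible_def)
                  qed
                  then show "runs (Seq (Assign (arr 0 (Var 7)) (Var 9)) (Assign (Const 7) (Plus (Var 7) (Const 1)))) m7 2
                    (\<lambda>m'. m' 6 = i \<and> ?J (Suc i) (m'(6 := Suc i)))" by (simp only: one_add_one)
                qed (simp_all add: m7 admissible_def)
              qed (use m6 X in \<open>auto intro: ready_powers\<close>)
            qed
          next
            show "length (?L j) < 2 ^ width" using len j by simp
          qed (use m4 cur_end in \<open>auto simp: admissible_def simp del: dominating_list.simps\<close>)
          then show "runs (For 6 (Var 8) list_step) m4
            (card D * ((1 + ((n * (3 * n + 6) + 3) + (2 + 1))) + 2) + 2)
            (\<lambda>m'. m' 5 = j \<and> ?I (Suc j) (m'(5 := Suc j)))"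
          proof (rule runs_weaken)
            show "length (?L j) * ((1 + ((n * (3 * n + 6) + 3) + (2 + 1))) + 2) + 2
              \<le> card D * ((1 + ((n * (3 * n + 6) + 3) + (2 + 1))) + 2) + 2"
              using length_dominating_list_le[of j n E] j by (intro add_mono mult_le_mono1) simp_all
          qed
        qed
      next
        show "n < 2 ^ width" by (rule le_width[OF counters_le_width(1)])
      qed (use m2 in \<open>auto simp: admissible_def simp del: dominating_list.simps\<close>)
    qed
  qed
  then show ?thesis by (rule runs_weaken) (simp_all add: distrib_left del: dominating_list.simps)
qed

definition enumerated :: "memory \<Rightarrow> bool" where
  "enumerated m \<longleftrightarrow> ready m \<and> listed m (dominating_list n E n) \<and> m 7 = length (dominating_list n E n)"

lemma enumerated_upd [simp]:
  "r < 16 \<Longrightarrow> r \<noteq> 1 \<Longrightarrow> r \<noteq> 2 \<Longrightarrow> r \<noteq> 7 \<Longrightarrow> enumerated (m(r := v)) = enumerated m"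
  "enumerated (m(adr 2 i := v)) = enumerated m"
  by (simp_all add: enumerated_def)

lemma enumerated_simps [simp]:
  assumes "enumerated m"
  shows "m (Suc 0) = n" "m 2 = colours" "m 7 = length (dominating_list n E n)"
    "u \<le> n \<Longrightarrow> m (adr (Suc 0) u) = 2 ^ u"
    "i < length (dominating_list n E n) \<Longrightarrow> m (adr 0 i) = set_encode (dominating_list n E n ! i)"
  using assms by (simp_all add: enumerated_def listed_def)

abbreviation "Xs \<equiv> dominating_list n E n"

lemma nth_Xs_subset: "i < length Xs \<Longrightarrow> Xs ! i \<subseteq> {..<n}" "i < length Xs \<Longrightarrow> finite (Xs ! i)"
proof -
  assume "i < length Xs"
  then have "Xs ! i \<in> D" using set_dominating_list(2)[of n E] nth_mem by blast
  then show "Xs ! i \<subseteq> {..<n}" by (simp add: dominating_sets_def)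
  then show "finite (Xs ! i)" using finite_subset by blast
qed

lemma length_Xs: "length Xs \<le> card D" "length Xs < 2 ^ width"
  using length_dominating_list_le[of n n E] D_le_width by auto

lemma table_val: "table m f \<Longrightarrow> X \<subseteq> {..<n} \<Longrightarrow> m (adr 2 (set_encode X)) = f X"
  by (simp add: table_def)

lemma order_less: "n < 2 ^ width" "n * n < 2 ^ width"
  by (auto intro: le_width counters_le_width)

lemma independent_iff:
  assumes "X \<subseteq> {..<n}"
  shows "(\<Sum>w<n * n. of_bool (w div n \<in> X) * of_bool (w mod n \<in> X) * of_bool ({w div n, w mod n} \<in> E)) = (0::nat)
    \<longleftrightarrow> independent_set {..<n} E X"
proof -
  have "{u, v} \<notin> E" if uv: "u \<in> X" "v \<in> X"
    and *: "\<And>w. w < n * n \<Longrightarrow> w div n \<in> X \<Longrightarrow> w mod n \<in> X \<Longrightarrow> {w div n, w mod n} \<notin> E" for u v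
  proof -
    have "u < n" "v < n" using assms uv by auto
    then have "u * n + v < Suc u * n" by simp
    also have "\<dots> \<le> n * n" using \<open>u < n\<close> by (intro mult_le_mono) auto
    finally show ?thesis using *[of "u * n + v"] \<open>v < n\<close> uv by simp
  qed
  then show ?thesis using assms by (auto simp: independent_set_def)
qed

lemma runs_mis:
  assumes m: "bounded_mem width m" "enumerated m" "table m (\<lambda>X. 0)"
  shows "runs mis_prog m (card D * (3 * (n * n) + 6) + 2)
    (\<lambda>m'. enumerated m' \<and> table m' (partial_mis_within n E 0))"
proof -
  \<comment> \<open>Domination is hidden in membership in the list: when all of \<open>Xs\<close>
    has been processed, this is the indicator of \<open>mis\<close>.\<close>
  let ?f = "\<lambda>i X. of_bool (X \<in> set (take i Xs) \<and> independent_set {..<n} E X) :: nat"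
  have "runs mis_prog m (length Xs * ((3 * (n * n) + 3) + 1 + 2) + 2)
    (\<lambda>m'. enumerated m' \<and> table m' (?f (length Xs)))"
    unfolding mis_prog_def
  proof (rule runs_For[where I = "\<lambda>i m'. enumerated m' \<and> table m' (?f i)"])
    fix i m1 assume i: "i < length Xs" and m1: "bounded_mem width m1" "enumerated m1 \<and> table m1 (?f i)" "m1 6 = i"
    define X where "X = Xs ! i"
    have X: "X \<subseteq> {..<n}" "finite X" using nth_Xs_subset[OF i] by (simp_all add: X_def)
    let ?F = "\<lambda>j. \<Sum>w<j. of_bool (w div n \<in> X) * of_bool (w mod n \<in> X) * of_bool ({w div n, w mod n} \<in> E) :: nat"
    have F_le: "?F j \<le> j" for j
      using sum_bounded_above[of "{..<j}"
          "\<lambda>w. of_bool (w div n \<in> X) * of_bool (w mod n \<in> X) * of_bool ({w div n, w mod n} \<in> E)" "1::nat"]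
      by simp
    show "runs (Seq (Accumulate 10 3 (Times (Var 1) (Var 1)) (Const 0) edge_count)
        (Assign (arr 2 (Cell (arr 0 (Var 6)))) (Minus (Const 1) (Var 10)))) m1 (3 * (n * n) + 3 + 1)
      (\<lambda>m'. m' 6 = i \<and> enumerated (m'(6 := Suc i)) \<and> table (m'(6 := Suc i)) (?f (Suc i)))"
    proof (rule runs_Seq)
      show "runs (Accumulate 10 3 (Times (Var 1) (Var 1)) (Const 0) edge_count) m1 (3 * (n * n) + 3)
        (\<lambda>m'. m' = m1(10 := ?F (n * n), 3 := n * n))"
      proof (rule runs_Accumulate)
        fix j assume j: "j < n * n"
        then have n: "0 < n" by (cases n) auto
        then have jn: "j div n < n" "j mod n < n" using j by (auto simp: less_mult_imp_div_less)
        let ?m = "m1(10 := ?F j, 3 := j)"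
        have "val input ?m (member_expr (Cell (arr 0 (Var 6))) (Div (Var 3) (Var 1))) = of_bool (j div n \<in> X)"
          using m1 i jn X by (subst val_member_expr) (simp_all add: X_def)
        moreover have "val input ?m (member_expr (Cell (arr 0 (Var 6)))
            (Minus (Var 3) (Times (Var 1) (Div (Var 3) (Var 1))))) = of_bool (j mod n \<in> X)"
          using m1 i jn X by (subst val_member_expr) (simp_all add: X_def minus_mult_div_eq_mod)
        ultimately show "val input ?m edge_count = ?F (Suc j)"
          by (simp add: edge_count_def cell_edge[OF j])
      next
        fix j assume "j \<le> n * n"
        then show "?F j < 2 ^ width" using F_le[of j] order_less(2) by linarith
      qed (use m1 order_less in \<open>simp_all add: admissible_def edge_count_def\<close>)
    next
      fix m2 assume m2: "bounded_mem width m2" "m2 = m1(10 := ?F (n * n), 3 := n * n)"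
      have ind: "1 - ?F (n * n) = of_bool (independent_set {..<n} E X)"
        by (rule one_minus_of_bool[OF independent_iff[OF X(1)]])
      have tab: "table (m2(adr 2 (set_encode X) := of_bool (independent_set {..<n} E X))) (?f (Suc i))"
        using m1 m2 X i by (intro table_fun_upd[where f = "?f i"]) (auto simp: take_Suc_conv_app_nth X_def)
      show "runs (Assign (arr 2 (Cell (arr 0 (Var 6)))) (Minus (Const 1) (Var 10))) m2 1
        (\<lambda>m'. m' 6 = i \<and> enumerated (m'(6 := Suc i)) \<and> table (m'(6 := Suc i)) (?f (Suc i)))"
      proof (rule runs_Assign)
        have a: "val input m2 (arr 2 (Cell (arr 0 (Var 6)))) = adr 2 (set_encode X)"
          using m1 m2(2) i by (simp add: X_def)
        have v: "val input m2 (Minus (Const 1) (Var 10)) = of_bool (independent_set {..<n} E X)"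
          using m2(2) ind by simp
        show "val input m2 (Minus (Const 1) (Var 10)) < 2 ^ width"
          unfolding v using le_width[of 1] b by simp
        show "(m2(val input m2 (arr 2 (Cell (arr 0 (Var 6)))) := val input m2 (Minus (Const 1) (Var 10)))) 6 = i
          \<and> enumerated ((m2(val input m2 (arr 2 (Cell (arr 0 (Var 6)))) := val input m2 (Minus (Const 1) (Var 10))))(6 := Suc i))
          \<and> table ((m2(val input m2 (arr 2 (Cell (arr 0 (Var 6)))) := val input m2 (Minus (Const 1) (Var 10))))(6 := Suc i)) (?f (Suc i))"
          unfolding a v using m1 m2(2) tab by simp
      qed (simp_all add: m2(1) admissible_def)
    qed
  qed (use m length_Xs in \<open>simp_all add: admissible_def\<close>)
  then show ?thesis
  proof (rule runs_weaken)
    have "?f (length Xs) = partial_mis_within n E 0"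
      by (rule ext) (simp add: partial_mis_within_0 mis_def set_dominating_list)
    then show "enumerated m' \<and> table m' (partial_mis_within n E 0)"
      if "enumerated m' \<and> table m' (?f (length Xs))" for m' using that by (simp only:)
  qed (use mult_le_mono1[OF length_Xs(1), of "6 + 3 * (n * n)"] in \<open>simp add: add.commute\<close>)
qed

lemma runs_zeta:
  assumes m: "bounded_mem width m" "enumerated m" "table m (partial_mis_within n E 0)"
  shows "runs zeta_prog m (n * (card D * 3 + 4) + 2)
    (\<lambda>m'. enumerated m' \<and> table m' (mis_within {..<n} E))"
proof -
  let ?p = "partial_mis_within n E"
  have "runs zeta_prog m (n * ((card D * (1 + 2) + 2) + 2) + 2) (\<lambda>m'. enumerated m' \<and> table m' (?p n))"
    unfolding zeta_prog_def
  proof (rule runs_For[where I = "\<lambda>j m'. enumerated m' \<and> table m' (?p j)"])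
    fix j m1 assume j: "j < n" and m1: "bounded_mem width m1" "enumerated m1 \<and> table m1 (?p j)" "m1 5 = j"
    \<comment> \<open>The table in the middle of round \<open>j\<close>: sets already visited have
      their new value, all others the old one.\<close>
    let ?f = "\<lambda>i X. if X \<in> set (take i Xs) then ?p (Suc j) X else ?p j X"
    have "runs (For 6 (Var 7) (Assign (arr 2 (Cell (arr 0 (Var 6)))) zeta_term)) m1 (length Xs * (1 + 2) + 2)
      (\<lambda>m'. m' 5 = j \<and> enumerated m' \<and> table m' (?f (length Xs)))"
    proof (rule runs_For[where I = "\<lambda>i m'. m' 5 = j \<and> enumerated m' \<and> table m' (?f i)"])
      fix i m2 assume i: "i < length Xs"
        and m2: "bounded_mem width m2" "m2 5 = j \<and> enumerated m2 \<and> table m2 (?f i)" "m2 6 = i"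
      define X where "X = Xs ! i"
      have X: "X \<subseteq> {..<n}" "finite X" using nth_Xs_subset[OF i] by (simp_all add: X_def)
      \<comment> \<open>By distinctness of the list, \<open>X\<close> has not been visited before in
        this round.\<close>
      have new: "X \<notin> set (take i Xs)"
        using set_dominating_list(1)[of n E] i by (auto simp: X_def in_set_conv_nth nth_eq_iff_index_eq)
      have a: "val input m2 (arr 2 (Cell (arr 0 (Var 6)))) = adr 2 (set_encode X)"
        using m2 i by (simp add: X_def)
      have here: "m2 (adr 2 (set_encode X)) = ?p j X"
        using m2 new table_val[of m2 "?f i" X] X by simp
      have bit: "val input m2 (member_expr (Cell (arr 0 (Var 6))) (Var 5)) = of_bool (j \<in> X)"
        using m2 i j X by (subst val_member_expr) (simp_all add: X_def)
      have below: "m2 (adr 2 (set_encode X - 2 ^ j)) = ?p j (X - {j})" if "j \<in> X"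
      proof -
        have "X - {j} \<subseteq> {..<n}" using X by auto
        then have "m2 (adr 2 (set_encode (X - {j}))) = ?f i (X - {j})"
          using m2 table_val[of m2 "?f i" "X - {j}"] by simp
        \<comment> \<open>Updating in place is safe: round \<open>j\<close> does not change the
          value at a set without \<open>j\<close>, so it does not matter whether
          \<open>X - {j}\<close> was visited before \<open>X\<close>.\<close>
        also have "\<dots> = ?p j (X - {j})" by (simp add: partial_mis_within_Suc)
        finally show ?thesis using set_encode_Diff[OF X(2) that] by simp
      qed
      have v: "val input m2 zeta_term = ?p (Suc j) X"
        unfolding zeta_term_def val.simps bit
        using m2 i j below here by (simp add: partial_mis_within_Suc X_def[symmetric])
      have tab: "table (m2(adr 2 (set_encode X) := ?p (Suc j) X)) (?f (Suc i))"
        using m2 X i by (intro table_fun_upd[where f = "?f i"]) (auto simp: take_Suc_conv_app_nth X_def)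
      show "runs (Assign (arr 2 (Cell (arr 0 (Var 6)))) zeta_term) m2 1
        (\<lambda>m'. m' 6 = i \<and> (m'(6 := Suc i)) 5 = j \<and> enumerated (m'(6 := Suc i)) \<and> table (m'(6 := Suc i)) (?f (Suc i)))"
      proof (rule runs_Assign)
        show "val input m2 zeta_term < 2 ^ width"
          unfolding v by (rule le_exp_width[OF partial_mis_within_le]) simp
        show "(m2(val input m2 (arr 2 (Cell (arr 0 (Var 6)))) := val input m2 zeta_term)) 6 = i
          \<and> ((m2(val input m2 (arr 2 (Cell (arr 0 (Var 6)))) := val input m2 zeta_term))(6 := Suc i)) 5 = j
          \<and> enumerated ((m2(val input m2 (arr 2 (Cell (arr 0 (Var 6)))) := val input m2 zeta_term))(6 := Suc i))
          \<and> table ((m2(val input m2 (arr 2 (Cell (arr 0 (Var 6)))) := val input m2 zeta_term))(6 := Suc i)) (?f (Suc i))"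
          unfolding a v using m2 tab by simp
      qed (simp_all add: m2(1) admissible_def zeta_term_def)
    qed (use m1 length_Xs in \<open>simp_all add: admissible_def\<close>)
    then show "runs (For 6 (Var 7) (Assign (arr 2 (Cell (arr 0 (Var 6)))) zeta_term)) m1 (card D * (1 + 2) + 2)
      (\<lambda>m'. m' 5 = j \<and> enumerated (m'(5 := Suc j)) \<and> table (m'(5 := Suc j)) (?p (Suc j)))"
    proof (rule runs_weaken)
      \<comment> \<open>Unlisted sets were not touched, and for them the old and the new value are
        both 0.\<close>
      have "?f (length Xs) X = ?p (Suc j) X" if "X \<subseteq> {..<n}" for X
        using partial_mis_within_not_dominating[OF that] set_dominating_list(2)[of n E]
        by (cases "X \<in> D") simp_all
      then show "m' 5 = j \<and> enumerated (m'(5 := Suc j)) \<and> table (m'(5 := Suc j)) (?p (Suc j))"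
        if "m' 5 = j \<and> enumerated m' \<and> table m' (?f (length Xs))" for m'
        using that by (simp add: table_def)
    qed (use length_Xs in simp)
  qed (use m order_less in \<open>simp_all add: admissible_def\<close>)
  then show ?thesis
    by (rule runs_weaken) (simp_all add: distrib_left table_def partial_mis_within_full)
qed

end

text \<open>The sum of the two truncated differences is nonzero iff the registers differ, and
  \<open>1 - (1 - x)\<close> turns any nonzero \<open>x\<close> into 1.\<close>

definition solve_prog :: prog where
  "solve_prog = Seq list_prog (Seq mis_prog (Seq zeta_prog (Seq sum_prog
    (Assign (Const 0) (Minus (Const 1) (Minus (Const 1)
      (Plus (Minus (Var 12) (Var 13)) (Minus (Var 13) (Var 12)))))))))"

text \<open>The offset skips \<open>n\<close>, the \<open>n * n\<close> matrix entries and the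
  sign.\<close>

definition digit :: expr where
  "digit = Input (Plus (Plus (Times (Var 1) (Var 1)) (Const 2)) (Var 3))"

text \<open>The end marker \<open>2\<close> counts as digit \<open>0\<close> and so do the cells behind it. The last loop checks
  that the marker is among the first \<open>n + 1\<close> cells; otherwise \<open>\<bar>k\<bar> \<ge> 2 ^ n\<close>.\<close>

definition init_prog :: prog where
  "init_prog = Seq (Assign (Const 1) (Input (Const 0)))
    (Seq (Assign (arr 1 (Const 0)) (Const 1))
      (Seq (For 3 (Var 1) (Assign (arr 1 (Plus (Var 3) (Const 1))) (Times (Const 2) (Cell (arr 1 (Var 3))))))
        (Seq (Accumulate 2 3 (Var 1) (Const 0) (Plus (Var 2) (Times (mod2 digit) (Cell (arr 1 (Var 3))))))
          (Accumulate 10 3 (Plus (Var 1) (Const 1)) (Const 0) (Plus (Var 10) (Div digit (Const 2)))))))"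

text \<open>The test \<open>n \<le> k\<close> precedes the test \<open>k = 0\<close>. So the empty
  graph with \<open>k = 0\<close> is accepted, and whenever \<open>k = 0\<close> is rejected there
  is a vertex left uncovered.\<close>

definition colouring_prog :: prog where
  "colouring_prog = Seq init_prog
    (If (Input (Plus (Times (Var 1) (Var 1)) (Const 1))) (Assign (Const 0) (Const 0))
      (If (Var 10)
        (If (Minus (Var 1) (Var 2))
          (If (Var 2) solve_prog (Assign (Const 0) (Const 0)))
          (Assign (Const 0) (Const 1)))
        (Assign (Const 0) (Const 1))))"

lemma sum_list_filter_le:
  fixes f :: "'a \<Rightarrow> nat"
  assumes "\<And>x. x \<in> set xs \<Longrightarrow> f x \<le> B"
  shows "(\<Sum>x\<leftarrow>filter P xs. f x) \<le> length xs * B"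
  using assms
proof (induction xs)
  case (Cons x xs)
  have "f x \<le> B" "(\<Sum>x\<leftarrow>filter P xs. f x) \<le> length xs * B" using Cons by auto
  then show ?case by simp
qed simp

lemma expr_size_mod2 [simp]: "expr_size (mod2 e) = 2 * expr_size e + 5"
  by (simp add: mod2_def)

lemma small_consts_mod2 [simp]: "small_consts (mod2 e) \<longleftrightarrow> small_consts e"
  by (auto simp: mod2_def)

context instance_graph
begin

definition parity_sum :: "nat \<Rightarrow> nat set list \<Rightarrow> nat" where
  "parity_sum p Ys = (\<Sum>X\<leftarrow>filter (\<lambda>X. card X mod 2 = p) Ys. mis_within {..<n} E X ^ colours)"

text \<open>Stated for all \<open>j\<close> up to the exponent because the power is built by
  repeated multiplication and every intermediate power must fit into a cell.\<close>

lemma mis_within_power_le: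
  assumes "colours \<le> n" "X \<subseteq> {..<n}" "j \<le> colours"
  shows "mis_within {..<n} E X ^ j \<le> 2 ^ (n * n)"
proof -
  have "mis_within {..<n} E X \<le> 2 ^ n"
    using partial_mis_within_le[of n E n X] partial_mis_within_full[OF assms(2)] by simp
  then have "mis_within {..<n} E X ^ j \<le> (2 ^ n) ^ j" by (rule power_mono) simp
  also have "\<dots> \<le> 2 ^ (n * n)"
    unfolding power_mult[symmetric] using assms by (intro power_increasing mult_le_mono) auto
  finally show ?thesis .
qed

lemma parity_sum_less:
  assumes "colours \<le> n" "length Ys \<le> card D" "set Ys \<subseteq> D"
  shows "parity_sum p Ys < 2 ^ width"
proof -
  have "parity_sum p Ys \<le> length Ys * 2 ^ (n * n)"
    unfolding parity_sum_def
  proof (rule sum_list_filter_le)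
    fix X assume "X \<in> set Ys"
    then have "X \<subseteq> {..<n}" using assms(3) by (auto simp: dominating_sets_def)
    then show "mis_within {..<n} E X ^ colours \<le> 2 ^ (n * n)" using assms(1) mis_within_power_le by simp
  qed
  also have "\<dots> \<le> 2 ^ n * 2 ^ (n * n)"
    using assms(2) card_dominating_sets_le_exp[of n E] by (intro mult_right_mono) auto
  finally show ?thesis by (intro le_exp_width[of _ "n + n * n"]) (simp_all add: power_add)
qed

lemma runs_sum:
  assumes m: "bounded_mem width m" "enumerated m" "table m (mis_within {..<n} E)" and le: "colours \<le> n"
  shows "runs sum_prog m (card D * (6 * n + 9) + 4)
    (\<lambda>m'. m' 12 = parity_sum 0 Xs \<and> m' 13 = parity_sum 1 Xs)"
proof -
  let ?f = "mis_within {..<n} E"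
  let ?I = "\<lambda>i m'. enumerated m' \<and> table m' ?f \<and> (\<forall>p<2. m' (12 + p) = parity_sum p (take i Xs))"
  let ?T = "(3 * colours + 3) + ((3 * n + 3) + 1)"
  have "runs sum_prog m (1 + (1 + (length Xs * (?T + 2) + 2))) (?I (length Xs))"
    unfolding sum_prog_def
  proof (rule runs_Seq)
    show "runs (Assign (Const 12) (Const 0)) m 1 (\<lambda>m'. enumerated m' \<and> table m' ?f \<and> m' 12 = 0)"
      using m by (intro runs_Assign) (simp_all add: admissible_def)
  next
    fix m1 assume m1: "bounded_mem width m1" "enumerated m1 \<and> table m1 ?f \<and> m1 12 = 0"
    show "runs (Seq (Assign (Const 13) (Const 0)) (For 6 (Var 7) sum_step)) m1 (1 + (length Xs * (?T + 2) + 2)) (?I (length Xs))"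
    proof (rule runs_Seq)
      show "runs (Assign (Const 13) (Const 0)) m1 1 (?I 0)"
        using m1 by (intro runs_Assign) (auto simp: admissible_def parity_sum_def less_2_cases_iff)
    next
      fix m2 assume m2: "bounded_mem width m2" "?I 0 m2"
      show "runs (For 6 (Var 7) sum_step) m2 (length Xs * (?T + 2) + 2) (?I (length Xs))"
      proof (rule runs_For[where I = ?I])
        fix i m3 assume i: "i < length Xs" and m3: "bounded_mem width m3" "?I i m3" "m3 6 = i"
        define X where "X = Xs ! i"
        have X: "X \<subseteq> {..<n}" "finite X" using nth_Xs_subset[OF i] by (simp_all add: X_def)
        let ?c = "\<lambda>j. card (X \<inter> {..<j})"
        have tab: "m3 (adr 2 (set_encode X)) = ?f X" using m3(2) X(1) table_val by blast
        show "runs sum_step m3 ?T (\<lambda>m'. m' 6 = i \<and> ?I (Suc i) (m'(6 := Suc i)))"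
          unfolding sum_step_def
        proof (rule runs_Seq)
          show "runs (Accumulate 10 3 (Var 2) (Const 1) (Times (Var 10) (Cell (arr 2 (Cell (arr 0 (Var 6))))))) m3
            (3 * colours + 3) (\<lambda>m'. m' = m3(10 := ?f X ^ colours, 3 := colours))"
          proof (rule runs_Accumulate)
            show "?f X ^ j < 2 ^ width" if "j \<le> colours" for j
              using mis_within_power_le[OF le X(1) that] by (intro le_exp_width[of _ "n * n"]) simp_all
            show "colours < 2 ^ width" using le counters_le_width(1) by (intro le_width) linarith
          qed (use m3 i tab in \<open>simp_all add: admissible_def X_def\<close>)
        next
          fix m4 assume m4: "bounded_mem width m4" "m4 = m3(10 := ?f X ^ colours, 3 := colours)"
          show "runs (Seq (Accumulate 11 3 (Var 1) (Const 0) (Plus (Var 11) (member_expr (Cell (arr 0 (Var 6))) (Var 3))))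
            (Assign (Plus (Const 12) (mod2 (Var 11))) (Plus (Cell (Plus (Const 12) (mod2 (Var 11)))) (Var 10)))) m4
            ((3 * n + 3) + 1) (\<lambda>m'. m' 6 = i \<and> ?I (Suc i) (m'(6 := Suc i)))"
          proof (rule runs_Seq)
            show "runs (Accumulate 11 3 (Var 1) (Const 0) (Plus (Var 11) (member_expr (Cell (arr 0 (Var 6))) (Var 3)))) m4
              (3 * n + 3) (\<lambda>m'. m' = m4(11 := ?c n, 3 := n))"
            proof (rule runs_Accumulate)
              fix j assume j: "j < n"
              let ?m = "m4(11 := ?c j, 3 := j)"
              have "val input ?m (member_expr (Cell (arr 0 (Var 6))) (Var 3)) = of_bool (j \<in> X)"
                using m3 m4(2) i j X by (subst val_member_expr) (simp_all add: X_def)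
              moreover have "?c (Suc j) = ?c j + of_bool (j \<in> X)"
                by (simp add: lessThan_Suc Int_insert_right)
              ultimately show "val input ?m (Plus (Var 11) (member_expr (Cell (arr 0 (Var 6))) (Var 3))) = ?c (Suc j)"
                by simp
            next
              fix j assume "j \<le> n"
              moreover have "?c j \<le> card {..<j}" by (intro card_mono) auto
              ultimately show "?c j < 2 ^ width" using order_less(1) by simp
            next
              show "bounded_mem width m4" by (rule m4(1))
            qed (use m3 m4(2) order_less in \<open>simp_all add: admissible_def\<close>)
          next
            fix m5 assume m5: "bounded_mem width m5" "m5 = m4(11 := ?c n, 3 := n)"
            define p where "p = card X mod 2"
            have p: "p < 2" by (simp add: p_def)
            have "X \<inter> {..<n} = X" using X(1) by auto
            then have a: "val input m5 (Plus (Const 12) (mod2 (Var 11))) = 12 + p"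
              using m5(2) by (simp add: p_def)
            have step: "parity_sum q (take (Suc i) Xs) = parity_sum q (take i Xs) + (if q = p then ?f X ^ colours else 0)" for q
              using i by (simp add: parity_sum_def take_Suc_conv_app_nth X_def p_def)
            have here: "m5 (12 + p) = parity_sum p (take i Xs)"
            proof -
              have "12 + p \<notin> {3, 10, 11}" by simp
              then have "m5 (12 + p) = m3 (12 + p)" unfolding m5(2) m4(2) by simp
              then show ?thesis using m3(2) p by simp
            qed
            have v: "val input m5 (Plus (Cell (Plus (Const 12) (mod2 (Var 11)))) (Var 10)) = parity_sum p (take (Suc i) Xs)"
            proof -
              have "val input m5 (Plus (Cell e) (Var 10)) = m5 (val input m5 e) + m5 10" for e by simp
              then show ?thesis unfolding step using a here m4(2) m5(2) by simp
            qed
            show "runs (Assign (Plus (Const 12) (mod2 (Var 11))) (Plus (Cell (Plus (Const 12) (mod2 (Var 11)))) (Var 10))) m5 1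
              (\<lambda>m'. m' 6 = i \<and> ?I (Suc i) (m'(6 := Suc i)))"
            proof (rule runs_Assign)
              have "set (take (Suc i) Xs) \<subseteq> D" using set_take_subset[of "Suc i" Xs] set_dominating_list(2)[of n E] by simp
              then show "val input m5 (Plus (Cell (Plus (Const 12) (mod2 (Var 11)))) (Var 10)) < 2 ^ width"
                unfolding v using length_Xs(1) by (intro parity_sum_less le) auto
              \<comment> \<open>Both sums are followed together, since the target register is known
                only through the parity \<open>p\<close>; neither is a temporary register of this
                step.\<close>
              have "\<forall>q<2. (m5(12 + p := parity_sum p (take (Suc i) Xs))) (12 + q) = parity_sum q (take (Suc i) Xs)"
              proof (intro allI impI)
                fix q :: nat assume "q < 2"
                have "12 + q \<notin> {3, 10, 11}" by simp
                then have "m5 (12 + q) = m3 (12 + q)" unfolding m5(2) m4(2) by simp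
                with m3(2) \<open>q < 2\<close> show "(m5(12 + p := parity_sum p (take (Suc i) Xs))) (12 + q) = parity_sum q (take (Suc i) Xs)"
                  using step[of q] by (auto split: if_splits)
              qed
              then show "(m5(val input m5 (Plus (Const 12) (mod2 (Var 11))) := val input m5 (Plus (Cell (Plus (Const 12) (mod2 (Var 11)))) (Var 10)))) 6 = i
                \<and> ?I (Suc i) ((m5(val input m5 (Plus (Const 12) (mod2 (Var 11))) := val input m5 (Plus (Cell (Plus (Const 12) (mod2 (Var 11)))) (Var 10))))(6 := Suc i))"
                unfolding a v using m3 m4(2) m5(2) p by simp
            qed (simp_all add: m5(1) admissible_def)
          qed
        qed
      qed (use m2 length_Xs in \<open>simp_all add: admissible_def\<close>)
    qed
  qed
  then show ?thesis
  proof (rule runs_weaken)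
    have "length Xs * (?T + 2) \<le> card D * (6 * n + 9)"
      using le length_Xs(1) by (intro mult_le_mono) auto
    then show "1 + (1 + (length Xs * (?T + 2) + 2)) \<le> card D * (6 * n + 9) + 4" by simp
    show "m' 12 = parity_sum 0 Xs \<and> m' 13 = parity_sum 1 Xs" if "?I (length Xs) m'" for m'
      using that[THEN conjunct2, THEN conjunct2, rule_format, of 0]
        that[THEN conjunct2, THEN conjunct2, rule_format, of 1] by simp
  qed
qed

lemma runs_solve:
  assumes m: "bounded_mem width m" "ready m" "table m (\<lambda>X. 0)" and c: "0 < colours" "colours \<le> n"
  shows "runs solve_prog m
    (n * (card D * (n * (3 * n + 6) + 9) + 5) + 4 + (card D * (3 * (n * n) + 6) + 2 +
      (n * (card D * 3 + 4) + 2 + (card D * (6 * n + 9) + 4 + 1))))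
    (\<lambda>m'. m' 0 = of_bool (coverable {..<n} E (int colours)))"
  unfolding solve_prog_def
proof (rule runs_Seq[OF runs_list[OF m]])
  let ?t = "Minus (Const 1) (Minus (Const 1) (Plus (Minus (Var 12) (Var 13)) (Minus (Var 13) (Var 12))))"
  fix m1 assume m1: "bounded_mem width m1"
    "ready m1 \<and> table m1 (\<lambda>X. 0) \<and> listed m1 Xs \<and> m1 7 = length Xs"
  then have "enumerated m1" "table m1 (\<lambda>X. 0)" by (simp_all add: enumerated_def)
  note mis = runs_mis[OF m1(1) this]
  show "runs (Seq mis_prog (Seq zeta_prog (Seq sum_prog (Assign (Const 0) ?t)))) m1
    (card D * (3 * (n * n) + 6) + 2 + (n * (card D * 3 + 4) + 2 + (card D * (6 * n + 9) + 4 + 1)))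
    (\<lambda>m'. m' 0 = of_bool (coverable {..<n} E (int colours)))"
  proof (rule runs_Seq[OF mis])
    fix m2 assume m2: "bounded_mem width m2" "enumerated m2 \<and> table m2 (partial_mis_within n E 0)"
    show "runs (Seq zeta_prog (Seq sum_prog (Assign (Const 0) ?t))) m2
      (n * (card D * 3 + 4) + 2 + (card D * (6 * n + 9) + 4 + 1))
      (\<lambda>m'. m' 0 = of_bool (coverable {..<n} E (int colours)))"
    proof (rule runs_Seq[OF runs_zeta])
      fix m3 assume m3: "bounded_mem width m3" "enumerated m3 \<and> table m3 (mis_within {..<n} E)"
      show "runs (Seq sum_prog (Assign (Const 0) ?t)) m3 (card D * (6 * n + 9) + 4 + 1)
        (\<lambda>m'. m' 0 = of_bool (coverable {..<n} E (int colours)))"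
      proof (rule runs_Seq[OF runs_sum])
        fix m4 assume m4: "bounded_mem width m4" "m4 12 = parity_sum 0 Xs \<and> m4 13 = parity_sum 1 Xs"
        have "coverable {..<n} E (int colours) \<longleftrightarrow>
            (\<Sum>X\<in>set Xs. (-1::int) ^ card X * int (mis_within {..<n} E X ^ colours)) \<noteq> 0"
          using coverable_iff_alternating_sum[OF _ graph c(1)] by (simp add: set_dominating_list)
        also have "\<dots> \<longleftrightarrow> parity_sum 0 Xs \<noteq> parity_sum 1 Xs"
          unfolding alternating_sum_split[OF set_dominating_list(1)]
          by (simp add: parity_sum_def even_iff_mod_2_eq_zero odd_iff_mod_2_eq_one)
        finally have iff: "coverable {..<n} E (int colours) \<longleftrightarrow> parity_sum 0 Xs \<noteq> parity_sum 1 Xs" .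
        have v: "val input m4 ?t = of_bool (coverable {..<n} E (int colours))"
          unfolding iff using m4(2) by simp
        show "runs (Assign (Const 0) ?t) m4 1 (\<lambda>m'. m' 0 = of_bool (coverable {..<n} E (int colours)))"
        proof (rule runs_Assign)
          show "val input m4 ?t < 2 ^ width"
            unfolding v using le_width[of 1] b by simp
          show "(m4(val input m4 (Const 0) := val input m4 ?t)) 0 = of_bool (coverable {..<n} E (int colours))"
            unfolding v by simp
        qed (simp_all add: m4(1) admissible_def)
      qed (use m3 c in simp_all)
    qed (use m2 in simp_all)
  qed
qed

section \<open>Reading the number of colours and the complete program\<close>

abbreviation "K \<equiv> nat \<bar>k\<bar>"

lemma K_bounds: "K < 2 ^ floorlog 2 K" "n < floorlog 2 K \<Longrightarrow> 2 ^ n \<le> K"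
proof -
  show "K < 2 ^ floorlog 2 K" by (rule floorlog_leD) simp_all
  show "2 ^ n \<le> K" if "n < floorlog 2 K"
    using floorlog_geD[of "Suc n" 2 K] that by simp
qed

lemma digit_parity: "cell (n * n + 2 + j) mod 2 = K div 2 ^ j mod 2"
proof (cases "j < floorlog 2 K")
  case True
  then show ?thesis unfolding cell_digit by simp
next
  case False
  then have "(2::nat) ^ floorlog 2 K \<le> 2 ^ j" by (intro power_increasing) auto
  then have "K < 2 ^ j" using K_bounds(1) by linarith
  with False show ?thesis unfolding cell_digit by simp
qed

lemma digit_marker: "cell (n * n + 2 + j) div 2 = of_bool (floorlog 2 K = j)"
  unfolding cell_digit by auto

lemma val_digit: "m 1 = n \<Longrightarrow> val input m digit = cell (n * n + 2 + m 3)"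
  by (simp add: digit_def)

lemma size_digit [simp]: "expr_size digit = 11" "small_consts digit"
  by (simp_all add: digit_def)

text \<open>At most \<open>n + 1\<close> cells of the digits of \<open>k\<close> are inspected, so
  the time depends on \<open>n\<close> alone, however long \<open>k\<close> is.\<close>

lemma runs_init:
  "runs init_prog (\<lambda>_. 0) (9 * n + 13)
    (\<lambda>m'. ready m' \<and> table m' (\<lambda>X. 0) \<and> m' 10 = of_bool (floorlog 2 K \<le> n))"
proof -
  let ?P = "\<lambda>m j. m 1 = n \<and> (\<forall>u\<le>j. m (adr 1 u) = 2 ^ u) \<and> table m (\<lambda>X. 0)"
  have pow: "2 ^ j < (2::nat) ^ width" if "j \<le> n" for j
    using that counters_le_width(2) by (intro power_strict_increasing) auto
  have "runs init_prog (\<lambda>_. 0) (1 + (1 + (n * (1 + 2) + 2 + ((3 * n + 3) + (3 * (n + 1) + 3)))))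
    (\<lambda>m'. ready m' \<and> table m' (\<lambda>X. 0) \<and> m' 10 = of_bool (floorlog 2 K < n + 1))"
    unfolding init_prog_def
  proof (rule runs_Seq)
    show "runs (Assign (Const 1) (Input (Const 0))) (\<lambda>_. 0) 1 (\<lambda>m'. m' 1 = n \<and> table m' (\<lambda>X. 0))"
      using order_less(1) by (intro runs_Assign) (auto simp: admissible_def bounded_mem_def table_def cell_0)
  next
    fix m1 assume m1: "bounded_mem width m1" "m1 1 = n \<and> table m1 (\<lambda>X. 0)"
    show "runs (Seq (Assign (arr 1 (Const 0)) (Const 1))
      (Seq (For 3 (Var 1) (Assign (arr 1 (Plus (Var 3) (Const 1))) (Times (Const 2) (Cell (arr 1 (Var 3))))))
        (Seq (Accumulate 2 3 (Var 1) (Const 0) (Plus (Var 2) (Times (mod2 digit) (Cell (arr 1 (Var 3))))))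
          (Accumulate 10 3 (Plus (Var 1) (Const 1)) (Const 0) (Plus (Var 10) (Div digit (Const 2))))))) m1
      (1 + (n * (1 + 2) + 2 + ((3 * n + 3) + (3 * (n + 1) + 3))))
      (\<lambda>m'. ready m' \<and> table m' (\<lambda>X. 0) \<and> m' 10 = of_bool (floorlog 2 K < n + 1))"
    proof (rule runs_Seq)
      show "runs (Assign (arr 1 (Const 0)) (Const 1)) m1 1 (\<lambda>m'. ?P m' 0)"
        using m1 pow[of 0] by (intro runs_Assign) (simp_all add: admissible_def table_def adr_eq_iff)
    next
      fix m2 assume m2: "bounded_mem width m2" "?P m2 0"
      show "runs (Seq (For 3 (Var 1) (Assign (arr 1 (Plus (Var 3) (Const 1))) (Times (Const 2) (Cell (arr 1 (Var 3))))))
        (Seq (Accumulate 2 3 (Var 1) (Const 0) (Plus (Var 2) (Times (mod2 digit) (Cell (arr 1 (Var 3))))))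
          (Accumulate 10 3 (Plus (Var 1) (Const 1)) (Const 0) (Plus (Var 10) (Div digit (Const 2)))))) m2
        (n * (1 + 2) + 2 + ((3 * n + 3) + (3 * (n + 1) + 3)))
        (\<lambda>m'. ready m' \<and> table m' (\<lambda>X. 0) \<and> m' 10 = of_bool (floorlog 2 K < n + 1))"
      proof (rule runs_Seq)
        show "runs (For 3 (Var 1) (Assign (arr 1 (Plus (Var 3) (Const 1))) (Times (Const 2) (Cell (arr 1 (Var 3)))))) m2
          (n * (1 + 2) + 2) (\<lambda>m'. ?P m' n)"
        proof (rule runs_For[where I = "\<lambda>j m'. ?P m' j"])
          fix j m3 assume j: "j < n" and m3: "bounded_mem width m3" "?P m3 j" "m3 3 = j"
          have "?P (m3(adr 1 (Suc j) := 2 ^ Suc j)) (Suc j)"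
            using m3(2) by (auto simp: adr_eq_iff table_def le_Suc_eq)
          then show "runs (Assign (arr 1 (Plus (Var 3) (Const 1))) (Times (Const 2) (Cell (arr 1 (Var 3))))) m3 1
            (\<lambda>m'. m' 3 = j \<and> ?P (m'(3 := Suc j)) (Suc j))"
            using m3 j pow[of "Suc j"] by (intro runs_Assign) (simp_all add: admissible_def)
        qed (use m2 order_less in \<open>simp_all add: admissible_def\<close>)
      next
        fix m4 assume m4: "bounded_mem width m4" "?P m4 n"
        show "runs (Seq (Accumulate 2 3 (Var 1) (Const 0) (Plus (Var 2) (Times (mod2 digit) (Cell (arr 1 (Var 3))))))
          (Accumulate 10 3 (Plus (Var 1) (Const 1)) (Const 0) (Plus (Var 10) (Div digit (Const 2))))) m4
          ((3 * n + 3) + (3 * (n + 1) + 3))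
          (\<lambda>m'. ready m' \<and> table m' (\<lambda>X. 0) \<and> m' 10 = of_bool (floorlog 2 K < n + 1))"
        proof (rule runs_Seq)
          show "runs (Accumulate 2 3 (Var 1) (Const 0) (Plus (Var 2) (Times (mod2 digit) (Cell (arr 1 (Var 3)))))) m4
            (3 * n + 3) (\<lambda>m'. m' = m4(2 := K mod 2 ^ n, 3 := n))"
          proof (rule runs_Accumulate)
            fix j assume j: "j < n"
            have "val input (m4(2 := K mod 2 ^ j, 3 := j)) digit mod 2 = K div 2 ^ j mod 2"
              using m4(2) by (subst val_digit) (simp_all only: fun_upd_apply digit_parity, simp_all)
            then show "val input (m4(2 := K mod 2 ^ j, 3 := j)) (Plus (Var 2) (Times (mod2 digit) (Cell (arr 1 (Var 3)))))
                = K mod 2 ^ Suc j"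
              using m4(2) j mod_mult2_eq[of K "2 ^ j" 2] by (simp add: mult.commute)
          next
            fix j assume "j \<le> n"
            have "K mod 2 ^ j < 2 ^ j" by simp
            with pow[OF \<open>j \<le> n\<close>] show "K mod 2 ^ j < 2 ^ width" by linarith
          qed (use m4 order_less in \<open>simp_all add: admissible_def\<close>)
        next
          fix m5 assume m5: "bounded_mem width m5" "m5 = m4(2 := K mod 2 ^ n, 3 := n)"
          have "runs (Accumulate 10 3 (Plus (Var 1) (Const 1)) (Const 0) (Plus (Var 10) (Div digit (Const 2)))) m5
            (3 * (n + 1) + 3) (\<lambda>m'. m' = m5(10 := of_bool (floorlog 2 K < n + 1), 3 := n + 1))"
          proof (rule runs_Accumulate)
            fix j
            have "val input (m5(10 := of_bool (floorlog 2 K < j), 3 := j)) digit div 2 = of_bool (floorlog 2 K = j)"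
              using m4(2) m5(2) by (subst val_digit) (simp_all only: fun_upd_apply digit_marker, simp_all)
            then show "val input (m5(10 := of_bool (floorlog 2 K < j), 3 := j)) (Plus (Var 10) (Div digit (Const 2)))
                = of_bool (floorlog 2 K < Suc j)"
              by simp
          next
            show "of_bool (floorlog 2 K < j) < (2::nat) ^ width" for j
              using le_width[of 1] b by simp
            show "n + 1 < 2 ^ width" using counters_le_width(2) by (intro le_width) simp
            show "bounded_mem width m5" by (rule m5(1))
          qed (use m4(2) m5(2) in \<open>simp_all add: admissible_def\<close>)
          then show "runs (Accumulate 10 3 (Plus (Var 1) (Const 1)) (Const 0) (Plus (Var 10) (Div digit (Const 2)))) m5
            (3 * (n + 1) + 3) (\<lambda>m'. ready m' \<and> table m' (\<lambda>X. 0) \<and> m' 10 = of_bool (floorlog 2 K < n + 1))"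
          proof (rule runs_weaken)
            have "ready m5" "table m5 (\<lambda>X. 0)"
              using m4(2) unfolding m5(2) by (simp_all add: ready_def powers_def colours_def del: ready_simps enumerated_simps)
            then show "ready m' \<and> table m' (\<lambda>X. 0) \<and> m' 10 = of_bool (floorlog 2 K < n + 1)"
              if "m' = m5(10 := of_bool (floorlog 2 K < n + 1), 3 := n + 1)" for m'
              unfolding that by simp
          qed simp
        qed
      qed
    qed
  qed
  then show ?thesis by (rule runs_weaken) (simp_all add: less_Suc_eq_le)
qed

lemma runs_output:
  assumes "bounded_mem width m" "a \<le> 1" "1 \<le> T" "Q (m(0 := a))"
  shows "runs (Assign (Const 0) (Const a)) m T Q"
proof (rule runs_weaken)
  show "runs (Assign (Const 0) (Const a)) m 1 Q"
    using assms le_width[of a] b by (intro runs_Assign) (auto simp: admissible_def)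
qed (use assms in auto)

lemma runs_colouring:
  "runs colouring_prog (\<lambda>_. 0)
    (9 * n + 13 + (n * (card D * (n * (3 * n + 6) + 9) + 5) + 4 + (card D * (3 * (n * n) + 6) + 2 +
      (n * (card D * 3 + 4) + 2 + (card D * (6 * n + 9) + 4 + 1))) + 4))
    (\<lambda>m'. m' 0 = of_bool (coverable {..<n} E k))"
  (is "runs _ _ (_ + (?T + 4)) ?Q")
  unfolding colouring_prog_def
proof (rule runs_Seq[OF runs_init])
  fix m assume m: "bounded_mem width m" "ready m \<and> table m (\<lambda>X. 0) \<and> m 10 = of_bool (floorlog 2 K \<le> n)"
  have yes: "coverable {..<n} E k" if "0 \<le> k" "n \<le> K"
    using coverable_of_card_le[OF _ graph, of K] that by simp
  have small: "colours = K" if "floorlog 2 K \<le> n"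
  proof -
    have "(2::nat) ^ floorlog 2 K \<le> 2 ^ n" using that by (intro power_increasing) auto
    then show ?thesis unfolding colours_def using K_bounds(1) by (intro mod_less) linarith
  qed
  show "runs (If (Input (Plus (Times (Var 1) (Var 1)) (Const 1))) (Assign (Const 0) (Const 0))
      (If (Var 10)
        (If (Minus (Var 1) (Var 2))
          (If (Var 2) solve_prog (Assign (Const 0) (Const 0)))
          (Assign (Const 0) (Const 1)))
        (Assign (Const 0) (Const 1)))) m (?T + 4) ?Q"
  proof (rule runs_weaken)
    show "runs (If (Input (Plus (Times (Var 1) (Var 1)) (Const 1))) (Assign (Const 0) (Const 0))
      (If (Var 10)
        (If (Minus (Var 1) (Var 2))
          (If (Var 2) solve_prog (Assign (Const 0) (Const 0)))
          (Assign (Const 0) (Const 1)))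
        (Assign (Const 0) (Const 1)))) m (?T + 1 + 1 + 1 + 1) ?Q"
    proof (rule runs_If)
      assume "val input m (Input (Plus (Times (Var 1) (Var 1)) (Const 1))) \<noteq> 0"
      then have "k < 0" using m(2) by (simp add: cell_sign split: if_splits)
      then have "\<not> coverable {..<n} E k" by (auto simp: coverable_def)
      then show "runs (Assign (Const 0) (Const 0)) m (?T + 1 + 1 + 1) ?Q" by (intro runs_output m) simp_all
    next
      assume "val input m (Input (Plus (Times (Var 1) (Var 1)) (Const 1))) = 0"
      then have k: "0 \<le> k" using m(2) by (simp add: cell_sign split: if_splits)
      show "runs (If (Var 10)
        (If (Minus (Var 1) (Var 2))
          (If (Var 2) solve_prog (Assign (Const 0) (Const 0)))
          (Assign (Const 0) (Const 1)))
        (Assign (Const 0) (Const 1))) m (?T + 1 + 1 + 1) ?Q"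
      proof (rule runs_If)
        assume "val input m (Var 10) = 0"
        then have "n < floorlog 2 K" using m(2) by (simp split: if_splits)
        then have "2 ^ n \<le> K" by (rule K_bounds(2))
        then have "n \<le> K" using less_exp[of n] by linarith
        with yes k show "runs (Assign (Const 0) (Const 1)) m (?T + 1 + 1) ?Q" by (intro runs_output m) simp_all
      next
        assume "val input m (Var 10) \<noteq> 0"
        then have cK: "colours = K" using m(2) small by (simp split: if_splits)
        show "runs (If (Minus (Var 1) (Var 2))
          (If (Var 2) solve_prog (Assign (Const 0) (Const 0)))
          (Assign (Const 0) (Const 1))) m (?T + 1 + 1) ?Q"
        proof (rule runs_If)
          assume "val input m (Minus (Var 1) (Var 2)) = 0"
          then have "n \<le> K" using m(2) cK by simp
          with yes k show "runs (Assign (Const 0) (Const 1)) m (?T + 1) ?Q" by (intro runs_output m) simp_all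
        next
          assume "val input m (Minus (Var 1) (Var 2)) \<noteq> 0"
          then have less: "K < n" using m(2) cK by simp
          show "runs (If (Var 2) solve_prog (Assign (Const 0) (Const 0))) m (?T + 1) ?Q"
          proof (rule runs_If)
            assume "val input m (Var 2) \<noteq> 0"
            then have "0 < colours" using m(2) by simp
            then show "runs solve_prog m ?T ?Q"
              using runs_solve[of m] m less cK k by simp
          next
            assume "val input m (Var 2) = 0"
            then have "k = 0" using m(2) cK k by simp
            then have "\<not> coverable {..<n} E k" using less by (auto simp: coverable_def)
            then show "runs (Assign (Const 0) (Const 0)) m ?T ?Q" by (intro runs_output m) simp_all
          qed (simp_all add: m(1) admissible_def)
        qed (simp_all add: m(1) admissible_def)
      qed (simp_all add: m(1) admissible_def)
    qed (simp_all add: m(1) admissible_def)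
  qed simp_all
qed

text \<open>The number of units is at most cubic in \<open>n + 1\<close> per dominating set, and a
  unit costs the square of a quadratic word length; this gives the exponent 3 + 4.\<close>

lemma time_bound:
  "(9 * n + 13 + (n * (card D * (n * (3 * n + 6) + 9) + 5) + 4 + (card D * (3 * (n * n) + 6) + 2 +
      (n * (card D * 3 + 4) + 2 + (card D * (6 * n + 9) + 4 + 1))) + 4)) * unit_cost
    \<le> 484000000000 * (n + 1) ^ 7 * card D"
proof -
  let ?s = "n + 1" and ?M = "card D"
  \<comment> \<open>The whole vertex set is dominating; therefore the additive terms can be absorbed
    into multiples of the count.\<close>
  have M: "1 \<le> ?M"
    using full_dominating[of "{..<n}" E] finite_dominating_sets[of "{..<n}" E]
    by (metis One_nat_def Suc_leI card_gt_0_iff empty_iff finite_lessThan)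
  have "9 * n + 13 + (n * (?M * (n * (3 * n + 6) + 9) + 5) + 4 + (?M * (3 * (n * n) + 6) + 2 +
      (n * (?M * 3 + 4) + 2 + (?M * (6 * n + 9) + 4 + 1))) + 4)
    = (3 * n ^ 3 + 9 * n ^ 2 + 18 * n + 15) * ?M + (18 * n + 30)"
    by (simp add: algebra_simps power2_eq_square power3_eq_cube)
  also have "\<dots> \<le> (3 * n ^ 3 + 9 * n ^ 2 + 18 * n + 15) * ?M + (18 * n + 30) * ?M"
    using M by simp
  also have "\<dots> = (3 * n ^ 3 + 9 * n ^ 2 + 36 * n + 45) * ?M" by (simp add: algebra_simps)
  also have "\<dots> \<le> (100 * ?s ^ 3) * ?M"
    by (intro mult_right_mono) (simp_all add: algebra_simps power2_eq_square power3_eq_cube)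
  finally have T: "9 * n + 13 + (n * (?M * (n * (3 * n + 6) + 9) + 5) + 4 + (?M * (3 * (n * n) + 6) + 2 +
      (n * (?M * 3 + 4) + 2 + (?M * (6 * n + 9) + 4 + 1))) + 4) \<le> (100 * ?s ^ 3) * ?M" .
  \<comment> \<open>The constant of the theorem arises here as
    \<open>100 * 40000000 * 11 ^ 2\<close>.\<close>
  have "width \<le> 11 * ?s ^ 2" unfolding width_def using one_le_power[of ?s 2] by simp
  then have "width ^ 2 \<le> (11 * ?s ^ 2) ^ 2" by (rule power_mono) simp
  then have "unit_cost \<le> 4840000000 * ?s ^ 4"
    unfolding unit_cost_def by (simp add: power_mult_distrib flip: power_mult)
  with T have "(9 * n + 13 + (n * (?M * (n * (3 * n + 6) + 9) + 5) + 4 + (?M * (3 * (n * n) + 6) + 2 +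
      (n * (?M * 3 + 4) + 2 + (?M * (6 * n + 9) + 4 + 1))) + 4)) * unit_cost
    \<le> (100 * ?s ^ 3) * ?M * (4840000000 * ?s ^ 4)" by (intro mult_mono) simp_all
  also have "\<dots> = 484000000000 * (?s ^ 3 * ?s ^ 4) * ?M" by simp
  also have "?s ^ 3 * ?s ^ 4 = ?s ^ 7" unfolding power_add[symmetric] by simp
  finally show ?thesis .
qed

end

theorem theorem3p6:
  shows "\<exists>(P :: prog) (C :: nat) (d :: nat). \<forall>(n :: nat) (E :: nat set set) (\<Delta> :: nat) (k :: int).
    simple_graph {..<n} E \<and> max_degree {..<n} E = \<Delta> \<longrightarrow>
    (\<exists>t. yields (encode n E k) P t (of_bool (coverable {..<n} E k)) \<and>
         real t \<le> real C * real (n + 1) ^ d * (2 ^ (\<Delta> + 1) - 1) powr (real n / real (\<Delta> + 1)))"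
proof (rule exI[of _ colouring_prog], rule exI[of _ 484000000000], rule exI[of _ 7], intro allI impI)
  fix n :: nat and E :: "nat set set" and \<Delta> :: nat and k :: int
  assume *: "simple_graph {..<n} E \<and> max_degree {..<n} E = \<Delta>"
  interpret instance_graph n E k by unfold_locales (use * in simp)
  obtain t m where t: "exec input colouring_prog (\<lambda>_. 0) t m" "m 0 = of_bool (coverable {..<n} E k)"
    and "t \<le> (9 * n + 13 + (n * (card D * (n * (3 * n + 6) + 9) + 5) + 4 + (card D * (3 * (n * n) + 6) + 2 +
      (n * (card D * 3 + 4) + 2 + (card D * (6 * n + 9) + 4 + 1))) + 4)) * unit_cost"
    using runs_colouring unfolding runs_def by blast
  then have "t \<le> 484000000000 * (n + 1) ^ 7 * card D" using time_bound by linarith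
  then have "real t \<le> real (484000000000 * (n + 1) ^ 7 * card D)" by (rule of_nat_mono)
  also have "\<dots> = real 484000000000 * real (n + 1) ^ 7 * real (card D)" by simp
  also have "\<dots> \<le> real 484000000000 * real (n + 1) ^ 7 * (2 ^ (\<Delta> + 1) - 1) powr (real n / real (\<Delta> + 1))"
    using card_dominating_sets_le[of "{..<n}" E] * by (intro mult_left_mono) simp_all
  finally show "\<exists>t. yields (encode n E k) colouring_prog t (of_bool (coverable {..<n} E k)) \<and>
    real t \<le> real 484000000000 * real (n + 1) ^ 7 * (2 ^ (\<Delta> + 1) - 1) powr (real n / real (\<Delta> + 1))"
    using t unfolding yields_def input_def by blast
qed

end
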